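(* Let $\mathcal H$ be a separable complex Hilbert space, let $p\in\mathbb N$ ($p\ge 1$), and let $\Phi_1,\ldots,\Phi_p\in\mathcal L_{\mathcal H}$ be compact operators such that the operator pencil $\Phi:\mathbb C\to\mathcal L_{\mathcal H}$, $\Phi(z)=\mathrm I-\sum_{j=1}^p z^j\Phi_j$, is noninvertible at $z=1$ and invertible at every other $z$ in the closed unit disk. Define $$\Pi_0=\Phi(1),\quad \Pi_1=\Phi^{(1)}(1),\quad \Pi_2=\tfrac12\Phi^{(2)}(1)-\Pi_1\Pi_0^+\Pi_1,\quad \Pi_3=\tfrac16\Phi^{(3)}(1)-\Pi_1\Pi_0^+\Pi_1\Pi_0^+\Pi_1,$$ $$\alpha_1=\operatorname{ran}\Pi_0,\quad \beta_1=(\ker\Pi_0)^\perp,\quad \alpha_2=\alpha_1+\Pi_1\beta_1^\perp,\quad \beta_2=\beta_1+\Pi_1^\ast\alpha_1^\perp,$$ and let $\Lambda_1:\beta_1^\perp\to\alpha_1^\perp$ be the operator obtained by restricting $\mathrm P_{\alpha_1^\perp}\Pi_1$ to $\beta_1^\perp$. Suppose that $\Phi(z)^{-1}$ does not have a simple pole at $z=1$. Then the following four conditions are equivalent. (1) $\Phi(z)^{-1}$ has a pole of second order at $z=1$. (2) The operator $\Lambda_2:\beta_2^\perp\to\alpha_2^\perp$ obtained by restricting $\mathrm P_{\alpha_2^\perp}\Pi_2$ to $\beta_2^\perp$ is bijective. (3) $\mathcal H=\alpha_2\oplus\Pi_2\beta_2^\perp$. (4) $\mathcal H=\alpha_2+\Pi_2\beta_2^\perp$.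 If $\Phi(z)^{-1}$ has a pole of second order at $z=1$, then the coefficients $\Upsilon_{-2}$ of $(z-1)^{-2}$ and $\Upsilon_{-1}$ of $(z-1)^{-1}$ in the Laurent series of $\Phi(z)^{-1}$ around $z=1$ are given by $$\Upsilon_{-2}=\Lambda_2^{-1}\mathrm P_{\alpha_2^\perp}$$ and $$\begin{aligned}\Upsilon_{-1}&=\Lambda_1^+\mathrm P_{\alpha_1^\perp}-\left[\Lambda_1^+\mathrm P_{\alpha_1^\perp}\Pi_2+\Pi_0^+\Pi_1\right]\Upsilon_{-2}-\Upsilon_{-2}\left[\Pi_2\Lambda_1^+\mathrm P_{\alpha_1^\perp}+\Pi_1\Pi_0^+\right]\\&\quad+\Upsilon_{-2}\left[\Pi_1\Pi_0^+\Pi_2+\Pi_2\Pi_0^+\Pi_1+\Pi_2\Lambda_1^+\mathrm P_{\alpha_1^\perp}\Pi_2-\Pi_3\right]\Upsilon_{-2},\end{aligned}$$ respectively.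
   Context: $\mathcal L_{\mathcal H}$ is the Banach space of continuous linear operators on $\mathcal H$ with the operator norm; $\mathrm I$ is the identity; $\Phi^{(k)}$ is the $k$th derivative of $\Phi$; $A^\ast$ is the adjoint of $A$. A superscript $+$ denotes the Moore-Penrose inverse of a continuous linear operator with closed range between Hilbert spaces (for $A:\mathcal H_1\to\mathcal H_2$, the operator $A^+:\mathcal H_2\to\mathcal H_1$ that is zero on $(\operatorname{ran}A)^\perp$ and inverts the bijection $A:(\ker A)^\perp\to\operatorname{ran}A$); in particular $\Lambda_1^+:\alpha_1^\perp\to\beta_1^\perp$. $V^\perp$ denotes orthogonal complement and $\mathrm P_V\in\mathcal L_{\mathcal H}$ the orthogonal projection on a closed subspace $V$. $AV=\{A(x):x\in V\}$. For linear subspaces, $V+W=\{v+w:v\in V,w\in W\}$; $\mathcal H=V\oplus W$ means that $\mathcal H=V+W$ and $V\cap W=\{0\}$ (the direct sum need not be orthogonal). $\Phi(z)^{-1}$ admits a Laurent series $\Phi(z)^{-1}=\sum_{k=-d}^\infty(z-1)^k\Upsilon_k$, convergent in $\mathcal L_{\mathcal H}$ on a punctured neighborhood of $1$, with $d\in\mathbb N$, $\Upsilon_k\in\mathcal L_{\mathcal H}$, $\Upsilon_{-d}\neq0$; then $\Phi(z)^{-1}$ has a pole of order $d$ at $z=1$ (simple if $d=1$). *)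

theory Defs
  imports "HOL-Analysis.Analysis" "HOL-Library.Set_Algebras"
begin

section \<open>Complex Hilbert spaces\<close>

class scaleC =
  fixes scaleC :: "complex \<Rightarrow> 'a \<Rightarrow> 'a" (infixr "*\<^sub>C" 75)

class complex_vector = scaleC + real_vector +
  assumes scaleC_add_right: "c *\<^sub>C (x + y) = c *\<^sub>C x + c *\<^sub>C y"
    and scaleC_add_left: "(c + d) *\<^sub>C x = c *\<^sub>C x + d *\<^sub>C x"
    and scaleC_scaleC: "c *\<^sub>C d *\<^sub>C x = (c * d) *\<^sub>C x"
    and scaleC_one: "1 *\<^sub>C x = x"
    and scaleR_scaleC: "r *\<^sub>R x = complex_of_real r *\<^sub>C x"

class complex_normed_vector = complex_vector + real_normed_vector +
  assumes norm_scaleC: "norm (c *\<^sub>C x) = cmod c * norm x"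

text \<open>The complex inner product is linear in its first argument. The underlying real inner
  product, which in Isabelle determines the norm, is its real part; hence
  the norm is the one induced by \<open>cinner\<close> and \<open>cinner\<close> is positive definite.\<close>

class complex_inner = complex_vector + real_inner +
  fixes cinner :: "'a \<Rightarrow> 'a \<Rightarrow> complex"
  assumes cinner_commute: "cinner x y = cnj (cinner y x)"
    and cinner_add_left: "cinner (x + y) z = cinner x z + cinner y z"
    and cinner_scaleC_left: "cinner (c *\<^sub>C x) y = c * cinner x y"
    and inner_eq_Re_cinner: "inner x y = Re (cinner x y)"
begin

lemma cinner_self: "cinner x x = complex_of_real ((norm x)\<^sup>2)"
proof -
  have "Im (cinner x x) = 0"
    using arg_cong[OF cinner_commute[of x x], of Im] by simp
  then show ?thesis
    by (simp add: complex_eq_iff power2_norm_eq_inner inner_eq_Re_cinner)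
qed

lemma cinner_scaleC_right: "cinner x (c *\<^sub>C y) = cnj c * cinner x y"
  by (metis cinner_commute cinner_scaleC_left complex_cnj_mult)

subclass complex_normed_vector
proof
  fix c x
  have "complex_of_real ((norm (c *\<^sub>C x))\<^sup>2) = (c * cnj c) * cinner x x"
    unfolding cinner_self[symmetric]
    by (simp only: cinner_scaleC_left cinner_scaleC_right mult.assoc mult.left_commute)
  also have "\<dots> = complex_of_real ((cmod c * norm x)\<^sup>2)"
    by (simp only: cinner_self complex_norm_square[symmetric] power_mult_distrib of_real_mult)
  finally have "complex_of_real ((norm (c *\<^sub>C x))\<^sup>2) = complex_of_real ((cmod c * norm x)\<^sup>2)" .
  then have "(norm (c *\<^sub>C x))\<^sup>2 = (cmod c * norm x)\<^sup>2"
    using of_real_eq_iff by blast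
  then show "norm (c *\<^sub>C x) = cmod c * norm x"
    by (simp add: power2_eq_iff_nonneg)
qed

end

class chilbert_space = complex_inner + complete_space

instantiation complex :: chilbert_space
begin

definition "scaleC_complex (c :: complex) (x :: complex) = c * x"
definition "cinner_complex (x :: complex) (y :: complex) = x * cnj y"

instance
  by standard
    (auto simp: scaleC_complex_def cinner_complex_def algebra_simps inner_complex_def
      scaleR_conv_of_real)

end


section \<open>Continuous linear operators\<close>

definition bounded_clinear :: "('a::complex_normed_vector \<Rightarrow> 'b::complex_normed_vector) \<Rightarrow> bool"
  where "bounded_clinear f \<longleftrightarrow> bounded_linear f \<and> (\<forall>c x. f (c *\<^sub>C x) = c *\<^sub>C f x)"

typedef (overloaded) ('a, 'b) cblinfun (\<open>(_ \<Rightarrow>\<^sub>C\<^sub>L /_)\<close> [22, 21] 21) =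
  "{f :: 'a::complex_normed_vector \<Rightarrow> 'b::complex_normed_vector. bounded_clinear f}"
  morphisms cblinfun_apply Cblinfun
proof
  have "c *\<^sub>C (0 :: 'b) = 0" for c
    using scaleC_add_right[of c "0 :: 'b" 0] by simp
  then show "(\<lambda>_. 0) \<in> {f :: 'a \<Rightarrow> 'b. bounded_clinear f}"
    by (simp add: bounded_clinear_def)
qed

declare [[coercion
  "cblinfun_apply :: ('a::complex_normed_vector \<Rightarrow>\<^sub>C\<^sub>L 'b::complex_normed_vector) \<Rightarrow> 'a \<Rightarrow> 'b"]]

setup_lifting type_definition_cblinfun

lemma cblinfun_eqI: "(\<And>x. cblinfun_apply A x = cblinfun_apply B x) \<Longrightarrow> A = B"
  by transfer auto

lemma complex_vector_zero_minus:
  fixes x y :: "'a::complex_vector"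
  shows "c *\<^sub>C (0 :: 'a) = 0" "c *\<^sub>C (- x) = - (c *\<^sub>C x)" "c *\<^sub>C (x - y) = c *\<^sub>C x - c *\<^sub>C y"
proof -
  show 0: "c *\<^sub>C (0 :: 'a) = 0"
    using scaleC_add_right[of c "0 :: 'a" 0] by simp
  show 1: "c *\<^sub>C (- x) = - (c *\<^sub>C x)" for x :: 'a
    using scaleC_add_right[of c x "- x"] 0 by (simp add: eq_neg_iff_add_eq_0 add.commute)
  show "c *\<^sub>C (x - y) = c *\<^sub>C x - c *\<^sub>C y"
    using scaleC_add_right[of c x "- y"] 1[of y] by simp
qed

lemma bounded_linear_scaleC_right: "bounded_linear (\<lambda>x :: 'a::complex_normed_vector. c *\<^sub>C x)"
  by (rule bounded_linear_intro[of _ "cmod c"])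
    (simp_all add: scaleC_add_right scaleR_scaleC scaleC_scaleC norm_scaleC mult.commute)

text \<open>The norm of \<open>'a \<Rightarrow>\<^sub>C\<^sub>L 'b\<close> is the operator norm.\<close>

instantiation cblinfun :: (complex_normed_vector, complex_normed_vector) complex_normed_vector
begin

lift_definition norm_cblinfun :: "('a \<Rightarrow>\<^sub>C\<^sub>L 'b) \<Rightarrow> real" is onorm .

lift_definition zero_cblinfun :: "'a \<Rightarrow>\<^sub>C\<^sub>L 'b" is "\<lambda>_. 0"
  by (simp add: bounded_clinear_def complex_vector_zero_minus)

lift_definition plus_cblinfun :: "('a \<Rightarrow>\<^sub>C\<^sub>L 'b) \<Rightarrow> ('a \<Rightarrow>\<^sub>C\<^sub>L 'b) \<Rightarrow> ('a \<Rightarrow>\<^sub>C\<^sub>L 'b)"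
  is "\<lambda>f g x. f x + g x"
  by (simp add: bounded_clinear_def bounded_linear_add scaleC_add_right)

lift_definition minus_cblinfun :: "('a \<Rightarrow>\<^sub>C\<^sub>L 'b) \<Rightarrow> ('a \<Rightarrow>\<^sub>C\<^sub>L 'b) \<Rightarrow> ('a \<Rightarrow>\<^sub>C\<^sub>L 'b)"
  is "\<lambda>f g x. f x - g x"
  by (simp add: bounded_clinear_def bounded_linear_sub complex_vector_zero_minus)

lift_definition uminus_cblinfun :: "('a \<Rightarrow>\<^sub>C\<^sub>L 'b) \<Rightarrow> ('a \<Rightarrow>\<^sub>C\<^sub>L 'b)" is "\<lambda>f x. - f x"
  by (simp add: bounded_clinear_def bounded_linear_minus complex_vector_zero_minus)

lift_definition scaleC_cblinfun :: "complex \<Rightarrow> ('a \<Rightarrow>\<^sub>C\<^sub>L 'b) \<Rightarrow> ('a \<Rightarrow>\<^sub>C\<^sub>L 'b)" is "\<lambda>c f x. c *\<^sub>C f x"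
  unfolding bounded_clinear_def
  by (intro conjI bounded_linear_compose[OF bounded_linear_scaleC_right])
    (simp_all add: scaleC_scaleC mult.commute)

lift_definition scaleR_cblinfun :: "real \<Rightarrow> ('a \<Rightarrow>\<^sub>C\<^sub>L 'b) \<Rightarrow> ('a \<Rightarrow>\<^sub>C\<^sub>L 'b)" is "\<lambda>r f x. r *\<^sub>R f x"
  unfolding bounded_clinear_def
  by (intro conjI bounded_linear_compose[OF bounded_linear_scaleR_right])
    (simp_all add: scaleR_scaleC scaleC_scaleC mult.commute)

definition dist_cblinfun :: "('a \<Rightarrow>\<^sub>C\<^sub>L 'b) \<Rightarrow> ('a \<Rightarrow>\<^sub>C\<^sub>L 'b) \<Rightarrow> real"
  where "dist_cblinfun A B = norm (A - B)"

definition sgn_cblinfun :: "('a \<Rightarrow>\<^sub>C\<^sub>L 'b) \<Rightarrow> ('a \<Rightarrow>\<^sub>C\<^sub>L 'b)"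
  where "sgn_cblinfun A = inverse (norm A) *\<^sub>R A"

definition uniformity_cblinfun :: "(('a \<Rightarrow>\<^sub>C\<^sub>L 'b) \<times> ('a \<Rightarrow>\<^sub>C\<^sub>L 'b)) filter"
  where "uniformity_cblinfun = (INF e\<in>{0<..}. principal {(A, B). dist A B < e})"

definition open_cblinfun :: "('a \<Rightarrow>\<^sub>C\<^sub>L 'b) set \<Rightarrow> bool"
  where "open_cblinfun S = (\<forall>A\<in>S. \<forall>\<^sub>F (A', B) in uniformity. A' = A \<longrightarrow> B \<in> S)"

instance
proof
  fix A B C :: "'a \<Rightarrow>\<^sub>C\<^sub>L 'b" and c d :: complex and r s :: real and U :: "('a \<Rightarrow>\<^sub>C\<^sub>L 'b) set"
  show "A + B + C = A + (B + C)"
    by transfer (simp add: add.assoc)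
  show "A + B = B + A"
    by transfer (simp add: add.commute)
  show "0 + A = A"
    by transfer (simp)
  show "- A + A = 0"
    by transfer (simp)
  show "A - B = A + - B"
    by transfer (simp)
  show "r *\<^sub>R (A + B) = r *\<^sub>R A + r *\<^sub>R B"
    by transfer (simp add: scaleR_add_right)
  show "(r + s) *\<^sub>R A = r *\<^sub>R A + s *\<^sub>R A"
    by transfer (simp add: scaleR_add_left)
  show "r *\<^sub>R s *\<^sub>R A = (r * s) *\<^sub>R A"
    by transfer (simp)
  show "1 *\<^sub>R A = A"
    by transfer (simp)
  show "c *\<^sub>C (A + B) = c *\<^sub>C A + c *\<^sub>C B"
    by transfer (simp add: scaleC_add_right)
  show "(c + d) *\<^sub>C A = c *\<^sub>C A + d *\<^sub>C A"
    by transfer (simp add: scaleC_add_left)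
  show "c *\<^sub>C d *\<^sub>C A = (c * d) *\<^sub>C A"
    by transfer (simp add: scaleC_scaleC)
  show "1 *\<^sub>C A = A"
    by transfer (simp add: scaleC_one)
  show "r *\<^sub>R A = complex_of_real r *\<^sub>C A"
    by transfer (simp add: scaleR_scaleC)
  show "dist A B = norm (A - B)" "sgn A = inverse (norm A) *\<^sub>R A"
    by (simp_all add: dist_cblinfun_def sgn_cblinfun_def)
  show "uniformity = (INF e\<in>{0<..}. principal {(A :: 'a \<Rightarrow>\<^sub>C\<^sub>L 'b, B). dist A B < e})"
    by (simp add: uniformity_cblinfun_def)
  show "open U = (\<forall>A\<in>U. \<forall>\<^sub>F (A', B) in uniformity. A' = A \<longrightarrow> B \<in> U)"
    by (simp add: open_cblinfun_def)
  show "norm A = 0 \<longleftrightarrow> A = 0"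
    by transfer (auto simp: bounded_clinear_def onorm_eq_0)
  show "norm (A + B) \<le> norm A + norm B"
    by transfer (auto simp: bounded_clinear_def intro: onorm_triangle)
  show "norm (r *\<^sub>R A) = \<bar>r\<bar> * norm A"
    by transfer (auto simp: bounded_clinear_def onorm_scaleR)
  show "norm (c *\<^sub>C A) = cmod c * norm A"
  proof transfer
    fix c :: complex and f :: "'a \<Rightarrow> 'b"
    assume "bounded_clinear f"
    then have "bounded_linear f"
      by (simp add: bounded_clinear_def)
    then have "onorm (\<lambda>x. cmod c *\<^sub>R f x) = cmod c * onorm f"
      by (simp add: onorm_scaleR)
    then show "onorm (\<lambda>x. c *\<^sub>C f x) = cmod c * onorm f"
      by (simp add: onorm_def norm_scaleC)
  qed
qed

end

lift_definition id_cblinfun :: "'a::complex_normed_vector \<Rightarrow>\<^sub>C\<^sub>L 'a" is "\<lambda>x. x"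
  by (simp add: bounded_clinear_def)

lift_definition cblinfun_compose ::
  "('b::complex_normed_vector \<Rightarrow>\<^sub>C\<^sub>L 'c::complex_normed_vector) \<Rightarrow>
   ('a::complex_normed_vector \<Rightarrow>\<^sub>C\<^sub>L 'b) \<Rightarrow> 'a \<Rightarrow>\<^sub>C\<^sub>L 'c" (infixl "o\<^sub>C\<^sub>L" 67)
  is "\<lambda>f g x. f (g x)"
  by (simp add: bounded_clinear_def bounded_linear_compose)

definition compact_cblinfun :: "('a::complex_normed_vector \<Rightarrow>\<^sub>C\<^sub>L 'b::complex_normed_vector) \<Rightarrow> bool"
  where "compact_cblinfun A \<longleftrightarrow> (\<forall>S. bounded S \<longrightarrow> compact (closure (A ` S)))"

definition is_inverse_cblinfun ::
  "('a::complex_normed_vector \<Rightarrow>\<^sub>C\<^sub>L 'b::complex_normed_vector) \<Rightarrow> ('b \<Rightarrow>\<^sub>C\<^sub>L 'a) \<Rightarrow> bool"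
  where "is_inverse_cblinfun A B \<longleftrightarrow> A o\<^sub>C\<^sub>L B = id_cblinfun \<and> B o\<^sub>C\<^sub>L A = id_cblinfun"

definition invertible_cblinfun ::
  "('a::complex_normed_vector \<Rightarrow>\<^sub>C\<^sub>L 'b::complex_normed_vector) \<Rightarrow> bool"
  where "invertible_cblinfun A \<longleftrightarrow> (\<exists>B. is_inverse_cblinfun A B)"

definition inverse_cblinfun ::
  "('a::complex_normed_vector \<Rightarrow>\<^sub>C\<^sub>L 'b::complex_normed_vector) \<Rightarrow> 'b \<Rightarrow>\<^sub>C\<^sub>L 'a"
  where "inverse_cblinfun A = (THE B. is_inverse_cblinfun A B)"

definition ker :: "('a::complex_normed_vector \<Rightarrow>\<^sub>C\<^sub>L 'b::complex_normed_vector) \<Rightarrow> 'a set"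
  where "ker A = {x. A x = 0}"

definition adjoint_cblinfun ::
  "('a::complex_inner \<Rightarrow>\<^sub>C\<^sub>L 'b::complex_inner) \<Rightarrow> 'b \<Rightarrow>\<^sub>C\<^sub>L 'a"
  where "adjoint_cblinfun A = (THE B :: 'b \<Rightarrow>\<^sub>C\<^sub>L 'a. \<forall>x y. cinner (A x) y = cinner x (B y))"

definition orth_compl :: "'a::complex_inner set \<Rightarrow> 'a set"
  where "orth_compl V = {x. \<forall>v\<in>V. cinner x v = 0}"

definition Proj :: "'a::complex_inner set \<Rightarrow> 'a \<Rightarrow>\<^sub>C\<^sub>L 'a"
  where "Proj V = (THE P :: 'a \<Rightarrow>\<^sub>C\<^sub>L 'a. \<forall>x. P x \<in> V \<and> x - P x \<in> orth_compl V)"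

text \<open>Operators between closed subspaces \<open>V\<close> and \<open>W\<close> are represented by operators on the ambient
  spaces that map \<open>V\<close> into \<open>W\<close>; only their values on \<open>V\<close> matter. \<open>mp_inverse V W A\<close> is the
  Moore-Penrose inverse of \<open>A : V \<rightarrow> W\<close> as an operator \<open>W \<rightarrow> V\<close>, represented by
  its extension by \<open>0\<close> to the orthogonal complement of \<open>W\<close>. The kernel, the range and their
  orthogonal complements are those of \<open>A : V \<rightarrow> W\<close>, taken relative to \<open>V\<close> and \<open>W\<close>.\<close>

definition mp_inverse ::
  "'a::complex_inner set \<Rightarrow> 'b::complex_inner set \<Rightarrow> ('a \<Rightarrow>\<^sub>C\<^sub>L 'b) \<Rightarrow> 'b \<Rightarrow>\<^sub>C\<^sub>L 'a"
  where "mp_inverse V W A = (THE B :: 'b \<Rightarrow>\<^sub>C\<^sub>L 'a.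
    (\<forall>y \<in> W \<inter> orth_compl (A ` V). B y = 0) \<and>
    (\<forall>x \<in> V \<inter> orth_compl (V \<inter> ker A). B (A x) = x) \<and>
    (\<forall>y \<in> orth_compl W. B y = 0))"


section \<open>Complex derivatives and Laurent series of operator-valued functions\<close>

text \<open>The real derivative is required to be complex linear, so \<open>D\<close> is the complex derivative.\<close>

definition cderiv :: "(complex \<Rightarrow> 'a::complex_normed_vector) \<Rightarrow> complex \<Rightarrow> 'a"
  where "cderiv F z = (THE D. (F has_derivative (\<lambda>h. h *\<^sub>C D)) (at z))"

text \<open>Laurent series at \<open>z\<^sub>0\<close>, starting at the power \<open>-d\<close>, of the pointwise operator inverse of
  \<open>F\<close>. Values of \<open>\<Upsilon>\<close> at indices below \<open>-d\<close> are irrelevant.\<close>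

definition inverse_has_laurent_series ::
  "(complex \<Rightarrow> 'a::complex_normed_vector \<Rightarrow>\<^sub>C\<^sub>L 'a) \<Rightarrow> complex \<Rightarrow> nat \<Rightarrow> (int \<Rightarrow> 'a \<Rightarrow>\<^sub>C\<^sub>L 'a) \<Rightarrow> bool"
  where "inverse_has_laurent_series F z\<^sub>0 d \<Upsilon> \<longleftrightarrow>
    (\<exists>r>0. \<forall>z. 0 < cmod (z - z\<^sub>0) \<and> cmod (z - z\<^sub>0) < r \<longrightarrow>
      invertible_cblinfun (F z) \<and>
      (\<lambda>n. (z - z\<^sub>0) powi (int n - int d) *\<^sub>C \<Upsilon> (int n - int d)) sums inverse_cblinfun (F z))"

definition inverse_has_pole_of_order ::
  "(complex \<Rightarrow> 'a::complex_normed_vector \<Rightarrow>\<^sub>C\<^sub>L 'a) \<Rightarrow> complex \<Rightarrow> nat \<Rightarrow> bool"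
  where "inverse_has_pole_of_order F z\<^sub>0 d \<longleftrightarrow>
    d \<ge> 1 \<and> (\<exists>\<Upsilon>. inverse_has_laurent_series F z\<^sub>0 d \<Upsilon> \<and> \<Upsilon> (- int d) \<noteq> 0)"

end

theory Submission
  imports Defs "HOL-Computational_Algebra.Formal_Power_Series"
begin

text \<open>Write \<open>\<Phi>(1 + w) = A\<^sub>0 + w A\<^sub>1 + w\<^sup>2 A\<^sub>2 + \<dots>\<close>. A series \<open>w\<^sup>-\<^sup>2 U + w\<^sup>-\<^sup>1 V + W + w X + \<dots>\<close> is a right
  inverse exactly if \<open>A\<^sub>0 U = 0\<close>, \<open>A\<^sub>0 V + A\<^sub>1 U = 0\<close>, \<open>A\<^sub>0 W + A\<^sub>1 V + A\<^sub>2 U = I\<close> and all later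
  coefficients of the product vanish. Eliminating \<open>V\<close> and \<open>W\<close> with the projections on the kernel and the cokernel of
  \<open>A\<^sub>0\<close> turns these three equations into: \<open>U\<close> takes values in \<open>\<beta>\<^sub>2\<^sup>\<bottom>\<close>, and its composition with \<open>\<Lambda>\<^sub>2\<close> is
  the projection on \<open>\<alpha>\<^sub>2\<^sup>\<bottom>\<close>. So a pole of second order makes \<open>\<Lambda>\<^sub>2\<close> onto. Conversely, if \<open>\<Lambda>\<^sub>2\<close> is
  invertible, the equations can be solved, and a solution of these three extends to a convergent
  Laurent series (\<open>right_parametrix_imp_laurent\<close>). The leading coefficient of that series
  is nonzero because otherwise \<open>\<Lambda>\<^sub>1\<close> would be invertible, and then the pole would be simple or
  \<open>\<Phi>(1)\<close> would be invertible.

  Closedness of \<open>\<alpha>\<^sub>2\<close>, and everything that a comparison of the dimensions of kernels and cokernels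
  would give, comes from Riesz theory of operators \<open>I - K\<close> with \<open>K\<close> compact: adding to
  \<open>T = I - K\<close> the compression of a compact operator \<open>D\<close> to \<open>ker T \<rightarrow> (ran T)\<^sup>\<bottom>\<close> gives another operator of this
  kind, called \<open>bordered T D\<close> below. Its range is \<open>ran T + D (ker T)\<close> and its kernel is the kernel of the
  compression. Bordering \<open>\<Phi>(1)\<close> with \<open>\<Pi>\<^sub>1\<close> gives an operator with range \<open>\<alpha>\<^sub>2\<close> and kernel \<open>\<beta>\<^sub>2\<^sup>\<bottom>\<close>;
  bordering that one with \<open>\<Pi>\<^sub>2\<close> gives an operator with range \<open>\<alpha>\<^sub>2 + \<Pi>\<^sub>2 \<beta>\<^sub>2\<^sup>\<bottom>\<close> and kernel \<open>ker \<Lambda>\<^sub>2\<close>. That an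
  operator \<open>I - K\<close> is injective if it is onto (\<open>id_minus_compact_surj_imp_inj\<close>) then gives
  the equivalence of bijectivity, direct sum and sum, and it also shows that right inverses of
  \<open>\<Phi>(z)\<close> are inverses, so that the equations for a right inverse suffice.

  The formula for \<open>V\<close> comes from the same elimination: the second equation gives its component
  orthogonal to \<open>ker A\<^sub>0\<close>, the third one the component in \<open>ker A\<^sub>0\<close> orthogonal to \<open>\<beta>\<^sub>2\<^sup>\<bottom>\<close>, and the equation
  for the coefficient of \<open>w\<close> the component in \<open>\<beta>\<^sub>2\<^sup>\<bottom>\<close>.\<close>

section \<open>Complex Hilbert spaces and orthogonal projections\<close>

instance chilbert_space \<subseteq> banach ..

lemmas scaleC_zero_right [simp] = complex_vector_zero_minus(1)
lemmas scaleC_minus_right [simp] = complex_vector_zero_minus(2)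
lemmas scaleC_diff_right = complex_vector_zero_minus(3)

lemma scaleC_zero_left [simp]: "0 *\<^sub>C (x :: 'a::complex_vector) = 0"
  using scaleC_add_left[of 0 0 x] by simp

lemma scaleC_minus_left [simp]: "(- c) *\<^sub>C (x :: 'a::complex_vector) = - (c *\<^sub>C x)"
  using scaleC_add_left[of c "- c" x] by (simp add: eq_neg_iff_add_eq_0 add.commute)

lemma scaleC_sum_right: "c *\<^sub>C (\<Sum>i\<in>I. f i) = (\<Sum>i\<in>I. c *\<^sub>C (f i :: 'a::complex_vector))"
  by (induction I rule: infinite_finite_induct) (simp_all add: scaleC_add_right)

lemma scaleC_sum_left: "(\<Sum>i\<in>I. f i) *\<^sub>C (x :: 'a::complex_vector) = (\<Sum>i\<in>I. f i *\<^sub>C x)"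
  by (induction I rule: infinite_finite_induct) (simp_all add: scaleC_add_left)

declare scaleC_one [simp]

lemma cinner_add_right: "cinner x (y + z) = cinner x y + cinner x (z :: 'a::complex_inner)"
  by (subst (1 2 3) cinner_commute) (simp add: cinner_add_left)

lemma cinner_minus_left [simp]: "cinner (- x) (y :: 'a::complex_inner) = - cinner x y"
  using cinner_scaleC_left[of "- 1" x y] by simp

lemma cinner_minus_right [simp]: "cinner x (- y :: 'a::complex_inner) = - cinner x y"
  using cinner_scaleC_right[of x "- 1" y] by simp

lemma cinner_diff_left: "cinner (x - y) (z :: 'a::complex_inner) = cinner x z - cinner y z"
  using cinner_add_left[of x "- y" z] by simp

lemma cinner_diff_right: "cinner x (y - z :: 'a::complex_inner) = cinner x y - cinner x z"
  using cinner_add_right[of x y "- z"] by simp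

lemma cinner_zero_left [simp]: "cinner 0 (y :: 'a::complex_inner) = 0"
  using cinner_scaleC_left[of 0 0 y] by simp

lemma cinner_zero_right [simp]: "cinner x (0 :: 'a::complex_inner) = 0"
  using cinner_scaleC_right[of x 0 0] by simp

lemma cinner_eq_zero_iff [simp]: "cinner x x = 0 \<longleftrightarrow> x = (0 :: 'a::complex_inner)"
  by (simp add: cinner_self)

lemma cinner_eq_zero_commute: "cinner x y = 0 \<longleftrightarrow> cinner y x = (0 :: complex)"
  by (metis cinner_commute complex_cnj_zero_iff)

lemma Im_cinner: "Im (cinner x y) = inner x (\<i> *\<^sub>C y)"
  by (simp add: inner_eq_Re_cinner cinner_scaleC_right)

lemma cinner_eq_inner:
  "cinner x y = complex_of_real (inner x y) + \<i> * complex_of_real (inner x (\<i> *\<^sub>C y))"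
  by (metis Im_cinner complex_eq inner_eq_Re_cinner)

lemma norm_cinner_le: "cmod (cinner x y) \<le> norm x * norm (y :: 'a::complex_inner)"
proof (cases "cinner x y = 0")
  case False
  \<comment> \<open>Rotating \<open>x\<close> by the phase of the inner product makes the latter real, and the real
    Cauchy--Schwarz inequality applies.\<close>
  define u where "u = cnj (cinner x y) / complex_of_real (cmod (cinner x y))"
  have [simp]: "cmod u = 1"
    using False by (simp add: u_def norm_divide)
  have "cinner (u *\<^sub>C x) y = complex_of_real (cmod (cinner x y))"
    using False
    by (simp add: u_def cinner_scaleC_left mult.commute[of "cnj _"]
        complex_norm_square[symmetric] power2_eq_square)
  then have "cmod (cinner x y) = inner (u *\<^sub>C x) y"
    by (simp add: inner_eq_Re_cinner)
  also have "\<dots> \<le> norm (u *\<^sub>C x) * norm y"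
    by (rule norm_cauchy_schwarz)
  finally show ?thesis
    by (simp add: norm_scaleC)
qed simp

lemma bounded_linear_cinner_left: "bounded_linear (\<lambda>x. cinner x (y :: 'a::complex_inner))"
  by (rule bounded_linear_intro[where K = "norm y"])
    (simp_all add: cinner_add_left scaleR_scaleC cinner_scaleC_left scaleC_complex_def norm_cinner_le)

definition closed_csubspace :: "'a::complex_normed_vector set \<Rightarrow> bool"
  where "closed_csubspace V \<longleftrightarrow>
    closed V \<and> 0 \<in> V \<and> (\<forall>x\<in>V. \<forall>y\<in>V. x + y \<in> V) \<and> (\<forall>c. \<forall>x\<in>V. c *\<^sub>C x \<in> V)"

lemma closed_csubspaceD:
  assumes "closed_csubspace V"
  shows "closed V" "0 \<in> V" "x \<in> V \<Longrightarrow> y \<in> V \<Longrightarrow> x + y \<in> V" "x \<in> V \<Longrightarrow> c *\<^sub>C x \<in> V"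
    "x \<in> V \<Longrightarrow> - x \<in> V" "x \<in> V \<Longrightarrow> y \<in> V \<Longrightarrow> x - y \<in> V" "x \<in> V \<Longrightarrow> r *\<^sub>R x \<in> V"
proof -
  show 0: "closed V" "0 \<in> V" "\<And>x y. x \<in> V \<Longrightarrow> y \<in> V \<Longrightarrow> x + y \<in> V" "\<And>c x. x \<in> V \<Longrightarrow> c *\<^sub>C x \<in> V"
    using assms by (auto simp: closed_csubspace_def)
  show 1: "x \<in> V \<Longrightarrow> - x \<in> V" for x
    using 0(4)[of x "- 1"] by (simp del: One_nat_def)
  show "x \<in> V \<Longrightarrow> y \<in> V \<Longrightarrow> x - y \<in> V"
    using 0(3)[of x "- y"] 1[of y] by auto
  show "x \<in> V \<Longrightarrow> r *\<^sub>R x \<in> V"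
    by (simp add: scaleR_scaleC 0)
qed

lemma closed_csubspace_UNIV [simp]: "closed_csubspace UNIV"
  by (simp add: closed_csubspace_def)

lemma closed_csubspace_Int: "closed_csubspace V \<Longrightarrow> closed_csubspace W \<Longrightarrow> closed_csubspace (V \<inter> W)"
  by (auto simp: closed_csubspace_def)

lemma closed_csubspace_orth_compl [simp]: "closed_csubspace (orth_compl V)"
proof -
  have "orth_compl V = (\<Inter>v\<in>V. (\<lambda>x. cinner x v) -` {0})"
    by (auto simp: orth_compl_def)
  moreover have "closed ((\<lambda>x. cinner x v) -` {0})" for v :: 'a
    by (intro continuous_closed_vimage closed_singleton linear_continuous_at
        bounded_linear_cinner_left)
  ultimately have "closed (orth_compl V)"
    by auto
  then show ?thesis
    by (simp add: closed_csubspace_def) (auto simp: orth_compl_def cinner_add_left cinner_scaleC_left)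
qed

lemma orth_compl_antimono: "V \<subseteq> W \<Longrightarrow> orth_compl W \<subseteq> orth_compl V"
  by (auto simp: orth_compl_def)

lemma subset_orth_compl_orth_compl: "V \<subseteq> orth_compl (orth_compl V)"
  by (auto simp: orth_compl_def cinner_eq_zero_commute)

lemma orth_compl_UNIV [simp]: "orth_compl (UNIV :: 'a::complex_inner set) = {0}"
proof -
  have "x = 0" if "x \<in> orth_compl UNIV" for x :: 'a
    using that cinner_eq_zero_iff[of x] by (simp add: orth_compl_def)
  then show ?thesis
    by (auto simp: orth_compl_def)
qed

lemma orth_compl_Int_self: "x \<in> V \<Longrightarrow> x \<in> orth_compl V \<Longrightarrow> x = 0"
  by (auto simp: orth_compl_def)

lemma norm_orthogonal_decomposition:
  fixes x y :: "'a::complex_inner"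
  assumes "cinner x y = 0"
  shows "(norm (x + y))\<^sup>2 = (norm x)\<^sup>2 + (norm y)\<^sup>2"
proof -
  have "inner x y = 0"
    by (simp add: inner_eq_Re_cinner assms)
  then show ?thesis
    by (simp add: power2_norm_eq_inner inner_add_left inner_add_right inner_commute)
qed

text \<open>A minimizing sequence for the distance from \<open>x\<close> to \<open>V\<close> is Cauchy by the parallelogram law.\<close>

lemma nearest_point_exists:
  fixes V :: "'a::chilbert_space set"
  assumes V: "closed_csubspace V"
  obtains v where "v \<in> V" "\<And>w. w \<in> V \<Longrightarrow> norm (x - v) \<le> norm (x - w)"
proof -
  define d where "d = infdist x V"
  have ne: "V \<noteq> {}" using closed_csubspaceD(2)[OF V] by auto
  have d_le: "d \<le> norm (x - w)" if "w \<in> V" for w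
    using infdist_le[OF that, of x] by (simp add: d_def dist_norm)
  have d0: "d \<ge> 0" by (simp add: d_def infdist_nonneg)
  have "\<exists>v. v \<in> V \<and> norm (x - v) < d + inverse (Suc n)" for n
  proof -
    have "infdist x V < d + inverse (Suc n)" by (simp add: d_def)
    then obtain v where "v \<in> V" "dist x v < d + inverse (Suc n)"
      using infdist_notempty[OF ne, of x]
        cInf_lessD[of "(\<lambda>a. dist x a) ` V" "d + inverse (Suc n)"] ne by auto
    then show ?thesis by (auto simp: dist_norm)
  qed
  then obtain v where v: "\<And>n. v n \<in> V" "\<And>n. norm (x - v n) < d + inverse (Suc n)"
    by metis
  have parallelogram: "(norm (v m - v n))\<^sup>2 \<le> 2 * (norm (x - v m))\<^sup>2 + 2 * (norm (x - v n))\<^sup>2 - 4 * d\<^sup>2" for m n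
  proof -
    have "(1/2) *\<^sub>R (v m + v n) \<in> V"
      using v(1) V by (auto intro!: closed_csubspaceD)
    then have "d \<le> norm (x - (1/2) *\<^sub>R (v m + v n))" by (rule d_le)
    then have "d\<^sup>2 \<le> (norm (x - (1/2) *\<^sub>R (v m + v n)))\<^sup>2"
      using d0 by (intro power_mono)
    moreover have "(norm (v m - v n))\<^sup>2 =
      2 * (norm (x - v m))\<^sup>2 + 2 * (norm (x - v n))\<^sup>2 - 4 * (norm (x - (1/2) *\<^sub>R (v m + v n)))\<^sup>2"
      by (simp add: power2_norm_eq_inner inner_diff_left inner_diff_right inner_add_left
          inner_add_right inner_commute algebra_simps)
    ultimately show ?thesis by simp
  qed
  have lim_norm: "(\<lambda>n. norm (x - v n)) \<longlonglongrightarrow> d"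
  proof (rule tendsto_sandwich[of "\<lambda>_. d" _ _ "\<lambda>n. d + inverse (Suc n)"])
    show "(\<lambda>n. d + inverse (real (Suc n))) \<longlonglongrightarrow> d"
      using tendsto_add[OF tendsto_const LIMSEQ_inverse_real_of_nat, of d] by simp
  qed (use v d_le in \<open>auto intro!: always_eventually simp: less_imp_le\<close>)
  have "Cauchy v"
  proof (rule CauchyI)
    fix e :: real assume "e > 0"
    have "(\<lambda>n. (norm (x - v n))\<^sup>2) \<longlonglongrightarrow> d\<^sup>2" by (intro tendsto_power lim_norm)
    then obtain N where N: "\<And>n. n \<ge> N \<Longrightarrow> (norm (x - v n))\<^sup>2 < d\<^sup>2 + e\<^sup>2 / 4"
      using order_tendstoD(2)[of _ "d\<^sup>2" sequentially "d\<^sup>2 + e\<^sup>2 / 4"] \<open>e > 0\<close>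
      by (auto simp: eventually_sequentially)
    have "norm (v m - v n) < e" if "m \<ge> N" "n \<ge> N" for m n
    proof -
      have "(norm (v m - v n))\<^sup>2 < e\<^sup>2"
        using parallelogram[of m n] N[OF that(1)] N[OF that(2)] by (simp add: field_simps)
      then show ?thesis
        using \<open>e > 0\<close> by (meson less_imp_le power_less_imp_less_base)
    qed
    then show "\<exists>M. \<forall>m\<ge>M. \<forall>n\<ge>M. norm (v m - v n) < e" by blast
  qed
  then obtain l where l: "v \<longlonglongrightarrow> l" by (auto simp: Cauchy_convergent_iff convergent_def)
  have "l \<in> V" using closed_sequentially[OF closed_csubspaceD(1)[OF V] v(1) l] .
  moreover have "(\<lambda>n. norm (x - v n)) \<longlonglongrightarrow> norm (x - l)" by (intro tendsto_intros l)
  then have "norm (x - l) = d" using lim_norm LIMSEQ_unique by blast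
  ultimately show thesis using that d_le by metis
qed

text \<open>Moving the nearest point \<open>v\<close> in a direction \<open>w\<close> of the subspace cannot decrease the distance,
  which makes the real inner product with \<open>w\<close> vanish; applied to \<open>\<i> w\<close> as well, this is complex
  orthogonality.\<close>

lemma orthogonal_decomposition_exists:
  fixes V :: "'a::chilbert_space set"
  assumes V: "closed_csubspace V"
  obtains v where "v \<in> V" "x - v \<in> orth_compl V"
proof -
  obtain v where v: "v \<in> V" "\<And>w. w \<in> V \<Longrightarrow> norm (x - v) \<le> norm (x - w)"
    using nearest_point_exists[OF V] by blast
  have real: "inner (x - v) w = 0" if w: "w \<in> V" for w
  proof (cases "w = 0")
    case False
    \<comment> \<open>The minimizer of the distance along the line through \<open>v\<close> in direction \<open>w\<close>.\<close>
    define t where "t = inner (x - v) w / inner w w"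
    have "v + t *\<^sub>R w \<in> V" using v(1) w V by (auto intro!: closed_csubspaceD)
    then have "norm (x - v) \<le> norm (x - (v + t *\<^sub>R w))" by (rule v(2))
    then have "(norm (x - v))\<^sup>2 \<le> (norm (x - v - t *\<^sub>R w))\<^sup>2"
      by (simp add: diff_diff_eq power_mono)
    also have "\<dots> = (norm (x - v))\<^sup>2 - 2 * t * inner (x - v) w + t * t * inner w w"
      unfolding power2_norm_eq_inner inner_diff_left[of "x - v"] inner_diff_right[of _ "x - v"]
        inner_commute[of w "x - v"] inner_scaleR_left inner_scaleR_right
      by (simp add: right_diff_distrib)
    also have "\<dots> = (norm (x - v))\<^sup>2 - (inner (x - v) w)\<^sup>2 / inner w w"
      using False by (simp add: t_def power2_eq_square)
    finally have "(inner (x - v) w)\<^sup>2 / inner w w \<le> 0" by simp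
    moreover have "inner w w > 0" using False by simp
    ultimately show ?thesis by (simp add: divide_le_0_iff)
  qed simp
  have "x - v \<in> orth_compl V"
    unfolding orth_compl_def
    using real closed_csubspaceD(4)[OF V] by (auto simp: cinner_eq_inner)
  with v(1) show thesis by (rule that)
qed

lemma orthogonal_decomposition_unique:
  assumes V: "closed_csubspace V" and "v \<in> V" "w \<in> V" "x - v \<in> orth_compl V" "x - w \<in> orth_compl V"
  shows "v = w"
proof -
  have "v - w \<in> V" using assms by (auto intro: closed_csubspaceD)
  moreover have "(x - w) - (x - v) \<in> orth_compl V"
    using assms closed_csubspaceD(6)[OF closed_csubspace_orth_compl] by blast
  ultimately show ?thesis using orth_compl_Int_self[of "v - w" V] by simp
qed

section \<open>Bounded operators\<close>

lemma cblinfun_bounded_linear: "bounded_linear (cblinfun_apply A)"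
  using cblinfun_apply[of A] by (simp add: bounded_clinear_def)

lemmas cblinfun_apply_add = linear_add[OF bounded_linear.linear[OF cblinfun_bounded_linear]]
lemmas cblinfun_apply_diff = linear_diff[OF bounded_linear.linear[OF cblinfun_bounded_linear]]
lemmas cblinfun_apply_minus = linear_neg[OF bounded_linear.linear[OF cblinfun_bounded_linear]]
lemmas cblinfun_apply_zero [simp] = linear_0[OF bounded_linear.linear[OF cblinfun_bounded_linear]]
lemmas cblinfun_apply_scaleR = linear_scale[OF bounded_linear.linear[OF cblinfun_bounded_linear]]

lemma cblinfun_apply_scaleC: "cblinfun_apply A (c *\<^sub>C x) = c *\<^sub>C A x"
  using cblinfun_apply[of A] by (simp add: bounded_clinear_def)

lemma cblinfun_apply_ops [simp]:
  "cblinfun_apply (A + B) x = A x + B x" "cblinfun_apply (A - B) x = A x - B x"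
  "cblinfun_apply (- A) x = - A x" "cblinfun_apply 0 x = 0"
  "cblinfun_apply (c *\<^sub>C A) x = c *\<^sub>C A x" "cblinfun_apply (r *\<^sub>R A) x = r *\<^sub>R A x"
  "cblinfun_apply id_cblinfun x = x" "cblinfun_apply (C o\<^sub>C\<^sub>L A) x = C (A x)"
  by (transfer; simp)+

lemma norm_cblinfun_apply_le: "norm (cblinfun_apply A x) \<le> norm A * norm x"
  by transfer (simp add: bounded_clinear_def onorm)

lemma norm_cblinfun_leI: "0 \<le> b \<Longrightarrow> (\<And>x. norm (cblinfun_apply A x) \<le> b * norm x) \<Longrightarrow> norm A \<le> b"
  by transfer (rule onorm_bound)

lemma norm_cblinfun_compose_le: "norm (A o\<^sub>C\<^sub>L B) \<le> norm A * norm B"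
proof (rule norm_cblinfun_leI)
  fix x
  have "norm (A (B x)) \<le> norm A * (norm B * norm x)"
    by (meson norm_cblinfun_apply_le mult_left_mono norm_ge_zero order_trans)
  then show "norm ((A o\<^sub>C\<^sub>L B) x) \<le> norm A * norm B * norm x"
    by (simp add: mult.assoc)
qed simp

lemma tendsto_cblinfun_apply: "(f \<longlongrightarrow> x) F \<Longrightarrow> ((\<lambda>n. cblinfun_apply A (f n)) \<longlongrightarrow> A x) F"
  by (rule bounded_linear.tendsto[OF cblinfun_bounded_linear])

lemma cblinfun_apply_Cblinfun:
  assumes "\<And>x y. f (x + y) = f x + f y" "\<And>c x. f (c *\<^sub>C x) = c *\<^sub>C f x" "\<And>x. norm (f x) \<le> norm x * K"
  shows "cblinfun_apply (Cblinfun f) = f"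
proof -
  have "bounded_linear f"
    using assms by (intro bounded_linear_intro[of f K]) (simp_all add: scaleR_scaleC)
  then show ?thesis
    by (intro Cblinfun_inverse) (simp add: bounded_clinear_def assms)
qed

text \<open>Operators form a closed subset of the complete space of bounded real-linear maps.\<close>

instance cblinfun :: (complex_normed_vector, chilbert_space) banach
proof
  fix X :: "nat \<Rightarrow> 'a \<Rightarrow>\<^sub>C\<^sub>L 'b"
  assume X: "Cauchy X"
  define Y where "Y n = Blinfun (X n)" for n
  have Y: "blinfun_apply (Y n) = X n" for n
    by (simp add: Y_def bounded_linear_Blinfun_apply cblinfun_bounded_linear)
  have normY: "norm (Y m - Y n) = norm (X m - X n)" for m n
    by (simp add: norm_blinfun.rep_eq norm_cblinfun.rep_eq minus_blinfun.rep_eq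
        minus_cblinfun.rep_eq Y)
  have "Cauchy Y"
    using X by (simp add: Cauchy_iff normY)
  then obtain L where L: "Y \<longlonglongrightarrow> L"
    by (auto simp: Cauchy_convergent_iff convergent_def)
  have lim: "(\<lambda>n. X n x) \<longlonglongrightarrow> blinfun_apply L x" for x
    using blinfun.tendsto[OF L tendsto_const] by (simp add: Y)
  have "blinfun_apply L (c *\<^sub>C x) = c *\<^sub>C blinfun_apply L x" for c x
  proof (rule LIMSEQ_unique[OF lim])
    show "(\<lambda>n. X n (c *\<^sub>C x)) \<longlonglongrightarrow> c *\<^sub>C blinfun_apply L x"
      unfolding cblinfun_apply_scaleC
      by (rule bounded_linear.tendsto[OF bounded_linear_scaleC_right lim])
  qed
  then have A: "cblinfun_apply (Cblinfun (blinfun_apply L)) = blinfun_apply L"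
    by (intro Cblinfun_inverse) (simp add: bounded_clinear_def blinfun.bounded_linear_right)
  have "norm (X n - Cblinfun (blinfun_apply L)) = norm (Y n - L)" for n
    by (simp add: norm_blinfun.rep_eq norm_cblinfun.rep_eq minus_blinfun.rep_eq
        minus_cblinfun.rep_eq Y A)
  moreover have "(\<lambda>n. norm (Y n - L)) \<longlonglongrightarrow> 0"
    using L by (simp add: LIM_zero tendsto_norm_zero)
  ultimately have "(\<lambda>n. X n - Cblinfun (blinfun_apply L)) \<longlonglongrightarrow> 0"
    by (intro tendsto_norm_zero_cancel[of "\<lambda>n. X n - Cblinfun (blinfun_apply L)"]) simp
  then have "X \<longlonglongrightarrow> Cblinfun (blinfun_apply L)"
    by (rule LIM_zero_cancel)
  then show "convergent X"
    by (auto simp: convergent_def)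
qed

lemma closed_csubspace_ker [simp]: "closed_csubspace (ker A)"
proof -
  have "ker A = cblinfun_apply A -` {0}" by (auto simp: ker_def)
  then have "closed (ker A)"
    by (simp add: continuous_closed_vimage linear_continuous_at cblinfun_bounded_linear)
  then show ?thesis
    by (simp add: closed_csubspace_def) (simp add: ker_def cblinfun_apply_add cblinfun_apply_scaleC)
qed

lemma closed_csubspace_image:
  assumes "closed_csubspace V" "closed (cblinfun_apply A ` V)"
  shows "closed_csubspace (cblinfun_apply A ` V)"
proof -
  have "0 \<in> A ` V"
    using closed_csubspaceD(2)[OF assms(1)] cblinfun_apply_zero[of A] by (metis imageI)
  moreover have "A x + A y \<in> A ` V" if "x \<in> V" "y \<in> V" for x y
    using closed_csubspaceD(3)[OF assms(1) that] by (metis cblinfun_apply_add imageI)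
  moreover have "c *\<^sub>C A x \<in> A ` V" if "x \<in> V" for c x
    using closed_csubspaceD(4)[OF assms(1) that] by (metis cblinfun_apply_scaleC imageI)
  ultimately show ?thesis
    using assms(2) by (auto simp: closed_csubspace_def)
qed

context
  fixes V :: "'a::chilbert_space set"
  assumes V: "closed_csubspace V"
begin

lemma Proj_works: "Proj V x \<in> V \<and> x - Proj V x \<in> orth_compl V"
proof -
  define f where "f x = (SOME v. v \<in> V \<and> x - v \<in> orth_compl V)" for x
  have f: "f x \<in> V" "x - f x \<in> orth_compl V" for x
    using orthogonal_decomposition_exists[OF V, of x] someI_ex[of "\<lambda>v. v \<in> V \<and> x - v \<in> orth_compl V"]
    unfolding f_def by blast+
  note W = closed_csubspaceD[OF closed_csubspace_orth_compl[of V]]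
  note unique = orthogonal_decomposition_unique[OF V]
  have "f (x + y) = f x + f y" for x y
    by (rule unique[of _ _ "x + y"])
      (use f W(3)[OF f(2)[of x] f(2)[of y]] V in \<open>auto intro: closed_csubspaceD simp: algebra_simps\<close>)
  moreover have "f (c *\<^sub>C x) = c *\<^sub>C f x" for c x
    by (rule unique[of _ _ "c *\<^sub>C x"])
      (use f W(4)[OF f(2)[of x]] V in \<open>auto intro: closed_csubspaceD simp flip: scaleC_diff_right\<close>)
  moreover have "norm (f x) \<le> norm x * 1" for x
  proof -
    have "cinner (x - f x) (f x) = 0"
      using f[of x] by (auto simp: orth_compl_def)
    then have "(norm (x - f x + f x))\<^sup>2 = (norm (x - f x))\<^sup>2 + (norm (f x))\<^sup>2"
      by (rule norm_orthogonal_decomposition)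
    then have "(norm (f x))\<^sup>2 \<le> (norm x)\<^sup>2" by simp
    then show ?thesis by simp
  qed
  ultimately have P: "cblinfun_apply (Cblinfun f) = f"
    by (rule cblinfun_apply_Cblinfun)
  have "\<exists>!P :: 'a \<Rightarrow>\<^sub>C\<^sub>L 'a. \<forall>x. P x \<in> V \<and> x - P x \<in> orth_compl V"
  proof (rule ex1I[of _ "Cblinfun f"])
    show "\<forall>x. Cblinfun f x \<in> V \<and> x - Cblinfun f x \<in> orth_compl V"
      using f P by simp
    fix Q :: "'a \<Rightarrow>\<^sub>C\<^sub>L 'a" assume "\<forall>x. Q x \<in> V \<and> x - Q x \<in> orth_compl V"
    then show "Q = Cblinfun f"
      using unique[OF _ f(1) _ f(2)] by (intro cblinfun_eqI) (simp add: P)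
  qed
  from theI'[OF this] show ?thesis
    unfolding Proj_def by blast
qed

lemma Proj_in [simp]: "Proj V x \<in> V"
  and Proj_orth: "x - Proj V x \<in> orth_compl V"
  using Proj_works by auto

lemma Proj_eqI: "v \<in> V \<Longrightarrow> x - v \<in> orth_compl V \<Longrightarrow> Proj V x = v"
  using orthogonal_decomposition_unique[OF V] Proj_in Proj_orth by blast

lemma Proj_fixes: "x \<in> V \<Longrightarrow> Proj V x = x"
  using closed_csubspaceD(2)[OF closed_csubspace_orth_compl] by (intro Proj_eqI) auto

lemma Proj_eq_0: "x \<in> orth_compl V \<Longrightarrow> Proj V x = 0"
  using closed_csubspaceD(2)[OF V] by (intro Proj_eqI) auto

lemma Proj_eq_0_iff: "Proj V x = 0 \<longleftrightarrow> x \<in> orth_compl V"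
  using Proj_eq_0 Proj_orth[of x] by auto

lemma orth_compl_orth_compl: "orth_compl (orth_compl V) = V"
proof
  show "V \<subseteq> orth_compl (orth_compl V)" by (rule subset_orth_compl_orth_compl)
  show "orth_compl (orth_compl V) \<subseteq> V"
  proof
    fix x assume x: "x \<in> orth_compl (orth_compl V)"
    have "Proj V x \<in> orth_compl (orth_compl V)"
      using subset_orth_compl_orth_compl[of V] Proj_in by blast
    then have "x - Proj V x \<in> orth_compl (orth_compl V)"
      using x closed_csubspaceD(6)[OF closed_csubspace_orth_compl] by blast
    then have "x - Proj V x = 0"
      using orth_compl_Int_self[OF Proj_orth] by blast
    then show "x \<in> V" using Proj_in[of x] by simp
  qed
qed

end

lemma Proj_orth_compl:
  assumes V: "closed_csubspace (V :: 'a::chilbert_space set)"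
  shows "Proj (orth_compl V) x = x - Proj V x"
  by (rule Proj_eqI[OF closed_csubspace_orth_compl])
    (simp_all add: Proj_orth[OF V] orth_compl_orth_compl[OF V] Proj_in[OF V])

section \<open>Compact operators and Riesz theory\<close>

lemma compact_closure_subset:
  fixes S :: "'a::metric_space set"
  assumes "S \<subseteq> C" "compact C"
  shows "compact (closure S)"
proof -
  have "closure S \<subseteq> C"
    using assms by (simp add: closure_minimal compact_imp_closed)
  then have "closure S = C \<inter> closure S"
    by blast
  also have "compact \<dots>"
    using assms(2) closed_closure by (rule compact_Int_closed)
  finally show ?thesis .
qed

lemma compact_cblinfun_zero: "compact_cblinfun 0"
  unfolding compact_cblinfun_def
proof (intro allI impI)
  fix S :: "'a set"
  show "compact (closure (cblinfun_apply (0 :: 'a \<Rightarrow>\<^sub>C\<^sub>L 'b) ` S))"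
    by (rule compact_closure_subset[of _ "{0}"]) auto
qed

lemma compact_cblinfun_add:
  assumes "compact_cblinfun A" "compact_cblinfun B"
  shows "compact_cblinfun (A + B)"
  unfolding compact_cblinfun_def
proof (intro allI impI)
  fix S :: "'a set" assume S: "bounded S"
  let ?C = "{x + y |x y. x \<in> closure (A ` S) \<and> y \<in> closure (B ` S)}"
  have "compact ?C"
    using assms S by (intro compact_sums) (auto simp: compact_cblinfun_def)
  moreover have "(A + B) ` S \<subseteq> ?C"
    using closure_subset[of "A ` S"] closure_subset[of "B ` S"] by fastforce
  ultimately show "compact (closure ((A + B) ` S))"
    by (rule compact_closure_subset[rotated])
qed

lemma compact_cblinfun_compose_left:
  assumes "compact_cblinfun A"
  shows "compact_cblinfun (B o\<^sub>C\<^sub>L A)"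
  unfolding compact_cblinfun_def
proof (intro allI impI)
  fix S :: "'a set" assume S: "bounded S"
  have "compact (B ` closure (A ` S))"
    using assms S
    by (intro compact_continuous_image linear_continuous_on cblinfun_bounded_linear)
      (simp add: compact_cblinfun_def)
  moreover have "(B o\<^sub>C\<^sub>L A) ` S \<subseteq> B ` closure (A ` S)"
    using closure_subset[of "A ` S"] by auto
  ultimately show "compact (closure ((B o\<^sub>C\<^sub>L A) ` S))"
    by (rule compact_closure_subset[rotated])
qed

lemma compact_cblinfun_compose_right:
  fixes B :: "'c::complex_normed_vector \<Rightarrow>\<^sub>C\<^sub>L 'a::complex_normed_vector"
  assumes "compact_cblinfun A"
  shows "compact_cblinfun (A o\<^sub>C\<^sub>L B)"
  unfolding compact_cblinfun_def
proof (intro allI impI)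
  fix S :: "'c set" assume S: "bounded S"
  have "bounded (B ` S)"
    using S cblinfun_bounded_linear by (rule bounded_linear_image)
  moreover have "(A o\<^sub>C\<^sub>L B) ` S = A ` (B ` S)"
    by auto
  ultimately show "compact (closure ((A o\<^sub>C\<^sub>L B) ` S))"
    using assms by (simp only: compact_cblinfun_def)
qed

lemma compact_cblinfun_scaleC:
  assumes "compact_cblinfun A"
  shows "compact_cblinfun (c *\<^sub>C A)"
proof -
  have "c *\<^sub>C A = (c *\<^sub>C id_cblinfun) o\<^sub>C\<^sub>L A"
    by (rule cblinfun_eqI) simp
  then show ?thesis
    using compact_cblinfun_compose_left[OF assms] by simp
qed

lemma compact_cblinfun_minus: "compact_cblinfun A \<Longrightarrow> compact_cblinfun (- A)"
  using compact_cblinfun_scaleC[of A "- 1"] by simp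

lemma compact_cblinfun_diff: "compact_cblinfun A \<Longrightarrow> compact_cblinfun B \<Longrightarrow> compact_cblinfun (A - B)"
  using compact_cblinfun_add[of A "- B"] compact_cblinfun_minus[of B] by simp

lemma compact_cblinfun_sum: "(\<And>i. i \<in> I \<Longrightarrow> compact_cblinfun (f i)) \<Longrightarrow> compact_cblinfun (\<Sum>i\<in>I. f i)"
  by (induction I rule: infinite_finite_induct)
    (auto intro: compact_cblinfun_zero compact_cblinfun_add)

lemma compact_cblinfun_subsequence:
  fixes x :: "nat \<Rightarrow> 'a::complex_normed_vector"
  assumes "compact_cblinfun A" "\<And>n. norm (x n) \<le> b"
  obtains r l where "strict_mono (r :: nat \<Rightarrow> nat)" "(\<lambda>n. A (x (r n))) \<longlonglongrightarrow> l"
proof -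
  have "bounded (range x)"
    using assms(2) by (auto simp: bounded_iff)
  then have "seq_compact (closure (A ` range x))"
    using assms(1) by (simp add: compact_cblinfun_def compact_eq_seq_compact_metric)
  moreover have "A (x n) \<in> closure (A ` range x)" for n
    using closure_subset[of "A ` range x"] by auto
  ultimately obtain l r where "strict_mono r" "((\<lambda>n. A (x n)) \<circ> r) \<longlonglongrightarrow> l"
    using seq_compactE[of "closure (A ` range x)" "\<lambda>n. A (x n)"] by blast
  then show thesis
    by (intro that) (simp_all add: o_def)
qed

text \<open>If the inverse were unbounded, there would be unit vectors \<open>u\<^sub>n \<bottom> ker T\<close> with \<open>T u\<^sub>n \<rightarrow> 0\<close>.
  Since \<open>u\<^sub>n - T u\<^sub>n\<close> is the image of \<open>u\<^sub>n\<close> under a compact operator, a subsequence of \<open>u\<^sub>n\<close> would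
  converge to a unit vector in the kernel and orthogonal to it.\<close>

lemma bounded_below_on_orth_compl_ker:
  fixes T :: "'a::chilbert_space \<Rightarrow>\<^sub>C\<^sub>L 'a"
  assumes K: "compact_cblinfun (id_cblinfun - T)"
  obtains c where "c > 0" "\<And>x. x \<in> orth_compl (ker T) \<Longrightarrow> c * norm x \<le> norm (T x)"
proof -
  have "\<exists>c>0. \<forall>x\<in>orth_compl (ker T). c * norm x \<le> norm (T x)"
  proof (rule ccontr)
    assume "\<not> ?thesis"
    then have "\<exists>x\<in>orth_compl (ker T). norm (T x) < inverse (real (Suc n)) * norm x" for n
      by (meson inverse_positive_iff_positive not_less of_nat_0_less_iff zero_less_Suc)
    then obtain x where x: "\<And>n. x n \<in> orth_compl (ker T)"
      "\<And>n. norm (T (x n)) < inverse (real (Suc n)) * norm (x n)"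
      by metis
    have x0: "x n \<noteq> 0" for n
      using x(2)[of n] by auto
    define u where "u n = inverse (norm (x n)) *\<^sub>R x n" for n
    have u: "u n \<in> orth_compl (ker T)" "norm (u n) = 1" for n
      using x(1)[of n] x0[of n] closed_csubspaceD(7)[OF closed_csubspace_orth_compl]
      by (simp_all add: u_def)
    have Tu: "norm (T (u n)) \<le> inverse (real (Suc n))" for n
      using x(2)[of n] x0[of n] by (simp add: u_def cblinfun_apply_scaleR field_simps less_imp_le)
    have "(\<lambda>n. norm (T (u n))) \<longlonglongrightarrow> 0"
      by (rule tendsto_sandwich[OF _ _ tendsto_const LIMSEQ_inverse_real_of_nat])
        (use Tu in \<open>auto intro: always_eventually\<close>)
    then have Tu0: "(\<lambda>n. T (u n)) \<longlonglongrightarrow> 0"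
      by (rule tendsto_norm_zero_cancel)
    obtain r l where r: "strict_mono (r :: nat \<Rightarrow> nat)"
      and l: "(\<lambda>n. (id_cblinfun - T) (u (r n))) \<longlonglongrightarrow> l"
      using compact_cblinfun_subsequence[OF K, of u 1] u(2) by (metis order_refl)
    have Tur: "(\<lambda>n. T (u (r n))) \<longlonglongrightarrow> 0"
      using LIMSEQ_subseq_LIMSEQ[OF Tu0 r] by (simp add: o_def)
    have ul: "(\<lambda>n. u (r n)) \<longlonglongrightarrow> l"
      using tendsto_add[OF l Tur] by simp
    have "l \<in> orth_compl (ker T)"
      using closed_sequentially[OF closed_csubspaceD(1)[OF closed_csubspace_orth_compl] u(1) ul] .
    moreover have "T l = 0"
      using LIMSEQ_unique[OF tendsto_cblinfun_apply[OF ul] Tur] .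
    ultimately have "l = 0"
      using orth_compl_Int_self[of l "ker T"] by (simp add: ker_def)
    moreover have "norm l = 1"
      using LIMSEQ_unique[OF tendsto_norm[OF ul], of 1] u(2) by simp
    ultimately show False
      by simp
  qed
  then show thesis
    using that by blast
qed

lemma range_eq_image_orth_compl_ker:
  fixes T :: "'a::chilbert_space \<Rightarrow>\<^sub>C\<^sub>L 'b::complex_normed_vector"
  shows "range T = T ` orth_compl (ker T)"
proof -
  have "T x = T (x - Proj (ker T) x)" for x
    using Proj_in[OF closed_csubspace_ker, of T x] by (simp add: cblinfun_apply_diff ker_def)
  then show ?thesis
    using Proj_orth[OF closed_csubspace_ker, of _ T] by blast
qed

text \<open>An operator that is bounded below maps complete subspaces to complete ones.\<close>

lemma closed_csubspace_range_id_minus_compact: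
  fixes T :: "'a::chilbert_space \<Rightarrow>\<^sub>C\<^sub>L 'a"
  assumes K: "compact_cblinfun (id_cblinfun - T)"
  shows "closed_csubspace (range T)"
proof -
  obtain c where c: "c > 0" "\<And>x. x \<in> orth_compl (ker T) \<Longrightarrow> c * norm x \<le> norm (T x)"
    using bounded_below_on_orth_compl_ker[OF K] by blast
  have "complete (T ` orth_compl (ker T))"
  proof (rule complete_isometric_image[OF c(1)])
    show "subspace (orth_compl (ker T))"
      using closed_csubspaceD(2,3,7)[OF closed_csubspace_orth_compl[of "ker T"]]
      by (simp add: subspace_def)
    show "complete (orth_compl (ker T))"
      by (simp add: complete_eq_closed closed_csubspaceD(1))
  qed (use c cblinfun_bounded_linear in auto)
  then have "closed (range T)"
    by (simp add: range_eq_image_orth_compl_ker complete_imp_closed)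
  then show ?thesis
    by (intro closed_csubspace_image) simp_all
qed

text \<open>Half of the Fredholm alternative. If \<open>T\<close> were onto with nontrivial kernel, the kernels of the
  powers of \<open>T\<close> would increase strictly, and unit vectors \<open>e\<^sub>n\<close> in \<open>ker T\<^sup>n\<^sup>+\<^sup>1\<close> orthogonal to
  \<open>ker T\<^sup>n\<close> would be mapped by the compact operator \<open>I - T\<close> to points at mutual distance at
  least 1.\<close>

lemma id_minus_compact_surj_imp_inj:
  fixes T :: "'a::chilbert_space \<Rightarrow>\<^sub>C\<^sub>L 'a"
  assumes K: "compact_cblinfun (id_cblinfun - T)" and surj: "range T = UNIV"
  shows "ker T = {0}"
proof (rule ccontr)
  assume "ker T \<noteq> {0}"
  then obtain x0 where x0: "T x0 = 0" "x0 \<noteq> 0"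
    using closed_csubspaceD(2)[OF closed_csubspace_ker[of T]] by (auto simp: ker_def)
  define pow where "pow n = ((\<lambda>A. T o\<^sub>C\<^sub>L A) ^^ n) id_cblinfun" for n
  have pow_simps: "pow 0 = id_cblinfun" "pow (Suc n) = T o\<^sub>C\<^sub>L pow n" for n
    by (simp_all add: pow_def)
  have pow_T: "pow n (T x) = T (pow n x)" for n x
    by (induction n) (simp_all add: pow_simps)
  have ker_mono: "ker (pow m) \<subseteq> ker (pow n)" if "m \<le> n" for m n
    using that by (induction n rule: dec_induct) (auto simp: ker_def pow_simps)
  have T_ker: "T x \<in> ker (pow n)" if "x \<in> ker (pow (Suc n))" for n x
    using that by (simp add: ker_def pow_simps pow_T)
  have chain: "\<exists>x. pow n x = x0" for n
  proof (induction n)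
    case (Suc n)
    then obtain x y where "pow n x = x0" "T y = x"
      using surj by (metis surjD)
    then show ?case
      by (intro exI[of _ y]) (simp add: pow_simps pow_T[symmetric])
  qed (simp add: pow_simps)
  have "\<exists>e. e \<in> ker (pow (Suc n)) \<and> e \<in> orth_compl (ker (pow n)) \<and> norm e = 1" for n
  proof -
    obtain x where x: "pow n x = x0"
      using chain by blast
    define y where "y = x - Proj (ker (pow n)) x"
    have P: "Proj (ker (pow n)) x \<in> ker (pow n)"
      by simp
    have y: "pow n y = x0" "y \<in> orth_compl (ker (pow n))"
      using P x Proj_orth[OF closed_csubspace_ker]
      by (simp_all add: y_def cblinfun_apply_diff ker_def)
    have y0: "y \<noteq> 0"
      using x0 y(1) by auto
    show ?thesis
    proof (intro exI conjI)
      show "inverse (norm y) *\<^sub>R y \<in> ker (pow (Suc n))"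
        using y x0 by (simp add: ker_def pow_simps cblinfun_apply_scaleR)
      show "inverse (norm y) *\<^sub>R y \<in> orth_compl (ker (pow n))"
        by (rule closed_csubspaceD(7)[OF closed_csubspace_orth_compl y(2)])
      show "norm (inverse (norm y) *\<^sub>R y) = 1"
        using y0 by simp
    qed
  qed
  then obtain e where e: "\<And>n. e n \<in> ker (pow (Suc n))" "\<And>n. e n \<in> orth_compl (ker (pow n))"
    "\<And>n. norm (e n) = 1"
    by metis
  let ?K = "id_cblinfun - T"
  have apart: "1 \<le> dist (?K (e n)) (?K (e m))" if "m < n" for m n
  proof -
    define z where "z = T (e n) + e m - T (e m)"
    have "T (e n) \<in> ker (pow n)" "e m \<in> ker (pow n)" "T (e m) \<in> ker (pow n)"
      using T_ker[OF e(1)[of n]] e(1)[of m] T_ker[OF e(1)[of m]]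
        ker_mono[of "Suc m" n] ker_mono[of m n] that by auto
    then have "- z \<in> ker (pow n)"
      unfolding z_def using closed_csubspaceD(3,5,6)[OF closed_csubspace_ker] by blast
    then have "cinner (e n) (- z) = 0"
      using e(2)[of n] by (auto simp del: cinner_minus_right simp: orth_compl_def)
    then have "(norm (e n + - z))\<^sup>2 = (norm (e n))\<^sup>2 + (norm (- z))\<^sup>2"
      by (rule norm_orthogonal_decomposition)
    then have "1\<^sup>2 \<le> (norm (e n - z))\<^sup>2"
      using e(3) by simp
    then have "1 \<le> norm (e n - z)"
      by (rule power2_le_imp_le) simp
    moreover have "?K (e n) - ?K (e m) = e n - z"
      by (simp add: z_def)
    ultimately show ?thesis
      by (simp only: dist_norm)
  qed
  obtain r l where r: "strict_mono (r :: nat \<Rightarrow> nat)" and l: "(\<lambda>n. ?K (e (r n))) \<longlonglongrightarrow> l"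
    using compact_cblinfun_subsequence[OF K, of e 1] e(3) by (metis order_refl)
  have "Cauchy (\<lambda>n. ?K (e (r n)))"
    using l by (rule LIMSEQ_imp_Cauchy)
  then obtain N where "\<And>m n. m \<ge> N \<Longrightarrow> n \<ge> N \<Longrightarrow> dist (?K (e (r m))) (?K (e (r n))) < 1"
    by (meson metric_CauchyD zero_less_one)
  then have "dist (?K (e (r (Suc N)))) (?K (e (r N))) < 1"
    by simp
  then show False
    using apart[OF strict_monoD[OF r], of N "Suc N"] by simp
qed

section \<open>Moore--Penrose inverses and adjoints\<close>

text \<open>The three conditions determine an operator because \<open>W\<^sup>\<bottom>\<close>, the complement of \<open>A V\<close> in \<open>W\<close> and the
  image under \<open>A\<close> of the complement of the kernel together span the space.\<close>

lemma mp_inverse_eqI: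
  fixes A :: "'a::chilbert_space \<Rightarrow>\<^sub>C\<^sub>L 'b::chilbert_space" and B :: "'b \<Rightarrow>\<^sub>C\<^sub>L 'a"
  assumes V: "closed_csubspace V" and W: "closed_csubspace W"
    and AV: "A ` V \<subseteq> W" "closed_csubspace (A ` V)"
    and B: "\<And>y. y \<in> W \<Longrightarrow> y \<in> orth_compl (A ` V) \<Longrightarrow> B y = 0"
      "\<And>x. x \<in> V \<Longrightarrow> x \<in> orth_compl (V \<inter> ker A) \<Longrightarrow> B (A x) = x"
      "\<And>y. y \<in> orth_compl W \<Longrightarrow> B y = 0"
  shows "mp_inverse V W A = B"
proof -
  have eq: "B' = B" if B': "(\<forall>y \<in> W \<inter> orth_compl (A ` V). B' y = 0) \<and>
    (\<forall>x \<in> V \<inter> orth_compl (V \<inter> ker A). B' (A x) = x) \<and> (\<forall>y \<in> orth_compl W. B' y = 0)"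
    for B' :: "'b \<Rightarrow>\<^sub>C\<^sub>L 'a"
  proof (rule cblinfun_eqI)
    fix y
    let ?w = "Proj W y"
    have "Proj (A ` V) ?w \<in> A ` V"
      using AV by simp
    then obtain v where v: "v \<in> V" "Proj (A ` V) ?w = A v"
      by auto
    have VK: "closed_csubspace (V \<inter> ker A)"
      using V by (intro closed_csubspace_Int) simp_all
    define x where "x = v - Proj (V \<inter> ker A) v"
    have P: "Proj (V \<inter> ker A) v \<in> V \<inter> ker A"
      using VK by (rule Proj_in)
    have x: "x \<in> V" "x \<in> orth_compl (V \<inter> ker A)" "A x = A v"
      using P v V Proj_orth[OF VK] closed_csubspaceD(6)[OF V]
      by (auto simp: x_def cblinfun_apply_diff ker_def)
    define s where "s = ?w - A x"
    have s: "s \<in> W" "s \<in> orth_compl (A ` V)"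
      using Proj_in[OF W] x AV(1) closed_csubspaceD(6)[OF W] Proj_orth[OF AV(2), of ?w] v
      by (auto simp: s_def)
    have y: "y = (y - ?w) + s + A x"
      by (simp add: s_def)
    have split: "C y = C (y - ?w) + C s + C (A x)" for C :: "'b \<Rightarrow>\<^sub>C\<^sub>L 'a"
      using arg_cong[OF y, of C] by (simp only: cblinfun_apply_add)
    have "y - ?w \<in> orth_compl W"
      by (rule Proj_orth[OF W])
    then have "B' (y - ?w) = 0" "B' s = 0" "B' (A x) = x" "B (y - ?w) = 0" "B s = 0" "B (A x) = x"
      using B' B s x(1,2) by blast+
    then show "B' y = B y"
      unfolding split[of B] split[of B'] by simp
  qed
  show ?thesis
    unfolding mp_inverse_def
  proof (rule the_equality)
    show "(\<forall>y \<in> W \<inter> orth_compl (A ` V). B y = 0) \<and>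
      (\<forall>x \<in> V \<inter> orth_compl (V \<inter> ker A). B (A x) = x) \<and> (\<forall>y \<in> orth_compl W. B y = 0)"
      using B by blast
  qed (rule eq)
qed

text \<open>The inverse of \<open>(ker T)\<^sup>\<bottom> \<rightarrow> ran T\<close> is bounded because \<open>T\<close> is bounded below on \<open>(ker T)\<^sup>\<bottom>\<close>.\<close>

lemma mp_inverse_id_minus_compact:
  fixes T :: "'a::chilbert_space \<Rightarrow>\<^sub>C\<^sub>L 'a"
  assumes K: "compact_cblinfun (id_cblinfun - T)"
  shows "T (mp_inverse UNIV UNIV T y) = y - Proj (orth_compl (range T)) y"
    and "mp_inverse UNIV UNIV T (T x) = x - Proj (ker T) x"
    and "y \<in> orth_compl (range T) \<Longrightarrow> mp_inverse UNIV UNIV T y = 0"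
    and "mp_inverse UNIV UNIV T y \<in> orth_compl (ker T)"
proof -
  note R = closed_csubspace_range_id_minus_compact[OF K]
  note N = closed_csubspaceD[OF closed_csubspace_orth_compl[of "ker T"]]
  obtain c where c: "c > 0" "\<And>x. x \<in> orth_compl (ker T) \<Longrightarrow> c * norm x \<le> norm (T x)"
    using bounded_below_on_orth_compl_ker[OF K] by blast
  have inj: "x = x'" if "x \<in> orth_compl (ker T)" "x' \<in> orth_compl (ker T)" "T x = T x'" for x x'
    using c(2)[OF N(6)[OF that(1,2)]] c(1) that(3)
    by (simp add: cblinfun_apply_diff mult_le_0_iff)
  define f where "f y = (SOME x. x \<in> orth_compl (ker T) \<and> T x = Proj (range T) y)" for y
  have f: "f y \<in> orth_compl (ker T)" "T (f y) = Proj (range T) y" for y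
  proof -
    have "Proj (range T) y \<in> T ` orth_compl (ker T)"
      using Proj_in[OF R] range_eq_image_orth_compl_ker by metis
    then have "\<exists>x. x \<in> orth_compl (ker T) \<and> T x = Proj (range T) y"
      by force
    from someI_ex[OF this] show "f y \<in> orth_compl (ker T)" "T (f y) = Proj (range T) y"
      unfolding f_def by blast+
  qed
  have G: "cblinfun_apply (Cblinfun f) = f"
  proof (rule cblinfun_apply_Cblinfun)
    show "f (x + y) = f x + f y" for x y
      by (rule inj) (use f N(3) in \<open>auto simp: cblinfun_apply_add\<close>)
    show "f (k *\<^sub>C x) = k *\<^sub>C f x" for k x
      by (rule inj) (use f N(4) in \<open>auto simp: cblinfun_apply_scaleC\<close>)
    show "norm (f x) \<le> norm x * (norm (Proj (range T)) / c)" for x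
    proof -
      have "c * norm (f x) \<le> norm (Proj (range T) x)"
        using c(2)[OF f(1)] f(2) by metis
      also have "\<dots> \<le> norm (Proj (range T)) * norm x"
        by (rule norm_cblinfun_apply_le)
      finally show ?thesis
        using c(1) by (simp add: field_simps)
    qed
  qed
  have mp: "mp_inverse UNIV UNIV T = Cblinfun f"
  proof (rule mp_inverse_eqI)
    show "Cblinfun f y = 0" if "y \<in> orth_compl (range T)" for y
      unfolding G by (rule inj) (use f N(2) Proj_eq_0[OF R that] in auto)
    show "Cblinfun f (T x) = x" if "x \<in> orth_compl (UNIV \<inter> ker T)" for x
      unfolding G by (rule inj) (use f that Proj_fixes[OF R] in auto)
  qed (use R in auto)
  show "T (mp_inverse UNIV UNIV T y) = y - Proj (orth_compl (range T)) y" for y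
    by (simp add: mp G f Proj_orth_compl[OF R])
  show "y \<in> orth_compl (range T) \<Longrightarrow> mp_inverse UNIV UNIV T y = 0" for y
    unfolding mp G by (rule inj) (use f N(2) Proj_eq_0[OF R] in auto)
  show "mp_inverse UNIV UNIV T y \<in> orth_compl (ker T)" for y
    by (simp add: mp G f)
  show "mp_inverse UNIV UNIV T (T x) = x - Proj (ker T) x" for x
    unfolding mp G
  proof (rule inj)
    show "T (f (T x)) = T (x - Proj (ker T) x)"
      using Proj_in[OF closed_csubspace_ker, of T x]
      by (simp add: f Proj_fixes[OF R] cblinfun_apply_diff ker_def)
  qed (use f Proj_orth[OF closed_csubspace_ker] in auto)
qed

text \<open>Riesz representation: a functional is represented by a multiple of a vector spanning the
  orthogonal complement of its kernel.\<close>

lemma Riesz_representation: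
  fixes f :: "'a::chilbert_space \<Rightarrow>\<^sub>C\<^sub>L complex"
  shows "\<exists>y. \<forall>x. f x = cinner x y"
proof (cases "ker f = UNIV")
  case True
  then show ?thesis
    by (intro exI[of _ 0]) (auto simp: ker_def)
next
  case False
  then obtain x0 where "x0 \<notin> ker f"
    by auto
  define e where "e = x0 - Proj (ker f) x0"
  have P: "Proj (ker f) x0 \<in> ker f"
    by simp
  have e: "e \<in> orth_compl (ker f)" "f e \<noteq> 0"
    using P \<open>x0 \<notin> ker f\<close> Proj_orth[OF closed_csubspace_ker]
    by (simp_all add: e_def cblinfun_apply_diff ker_def)
  then have e0: "cinner e e \<noteq> 0"
    by auto
  have "f x = cinner x (cnj (f e / cinner e e) *\<^sub>C e)" for x
  proof -
    have "f (f e *\<^sub>C x - f x *\<^sub>C e) = 0"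
      by (simp add: cblinfun_apply_diff cblinfun_apply_scaleC scaleC_complex_def)
    then have "cinner e (f e *\<^sub>C x - f x *\<^sub>C e) = 0"
      using e(1) by (simp add: orth_compl_def ker_def)
    then have "cinner (f e *\<^sub>C x - f x *\<^sub>C e) e = 0"
      by (simp add: cinner_eq_zero_commute)
    then have "f e * cinner x e = f x * cinner e e"
      by (simp add: cinner_diff_left cinner_scaleC_left)
    then show ?thesis
      using e0 by (simp add: cinner_scaleC_right field_simps)
  qed
  then show ?thesis
    by blast
qed

lemma cinner_right_cancel:
  fixes y z :: "'a::complex_inner"
  assumes "\<And>x. cinner x y = cinner x z"
  shows "y = z"
  using assms[of "y - z"] cinner_eq_zero_iff[of "y - z"] by (simp add: cinner_diff_right)

text \<open>Existence of the adjoint is the Riesz representation of \<open>x \<mapsto> \<langle>A x, y\<rangle>\<close>; linearity and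
  boundedness of the representing vector in \<open>y\<close> follow from its uniqueness.\<close>

lemma cinner_adjoint:
  fixes A :: "'a::chilbert_space \<Rightarrow>\<^sub>C\<^sub>L 'b::complex_inner"
  shows "cinner (A x) y = cinner x (adjoint_cblinfun A y)"
proof -
  have "\<exists>z. \<forall>x. cinner (A x) y = cinner x z" for y
  proof -
    have "cblinfun_apply (Cblinfun (\<lambda>x. cinner (A x) y)) = (\<lambda>x. cinner (A x) y)"
    proof (rule cblinfun_apply_Cblinfun)
      show "norm (cinner (A x) y) \<le> norm x * (norm A * norm y)" for x
      proof -
        have "norm (cinner (A x) y) \<le> norm (A x) * norm y"
          by (rule norm_cinner_le)
        also have "\<dots> \<le> norm A * norm x * norm y"
          by (intro mult_right_mono norm_cblinfun_apply_le) simp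
        finally show ?thesis
          by (simp add: mult_ac)
      qed
    qed (simp_all add: cblinfun_apply_add cblinfun_apply_scaleC cinner_add_left cinner_scaleC_left
        scaleC_complex_def)
    then show ?thesis
      using Riesz_representation by metis
  qed
  then obtain g where g: "\<And>x y. cinner (A x) y = cinner x (g y)"
    by metis
  have B: "cblinfun_apply (Cblinfun g) = g"
  proof (rule cblinfun_apply_Cblinfun)
    show "g (x + y) = g x + g y" for x y
      by (rule cinner_right_cancel) (simp add: g[symmetric] cinner_add_right)
    show "g (c *\<^sub>C y) = c *\<^sub>C g y" for c y
      by (rule cinner_right_cancel) (simp add: g[symmetric] cinner_scaleC_right)
    show "norm (g y) \<le> norm y * norm A" for y
    proof (cases "g y = 0")
      case False
      have "(norm (g y))\<^sup>2 = cmod (cinner (A (g y)) y)"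
        by (simp add: g cinner_self norm_power)
      also have "\<dots> \<le> norm (A (g y)) * norm y"
        by (rule norm_cinner_le)
      also have "\<dots> \<le> norm A * norm (g y) * norm y"
        by (intro mult_right_mono norm_cblinfun_apply_le) simp
      finally show ?thesis
        using False by (simp add: power2_eq_square mult_ac)
    qed simp
  qed
  have "\<exists>!B :: 'b \<Rightarrow>\<^sub>C\<^sub>L 'a. \<forall>x y. cinner (A x) y = cinner x (B y)"
  proof (rule ex1I[of _ "Cblinfun g"])
    show "\<forall>x y. cinner (A x) y = cinner x (Cblinfun g y)"
      by (simp add: B g)
    fix B' :: "'b \<Rightarrow>\<^sub>C\<^sub>L 'a" assume "\<forall>x y. cinner (A x) y = cinner x (B' y)"
    then have "cinner x (B' y) = cinner x (Cblinfun g y)" for x y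
      by (metis B g)
    then show "B' = Cblinfun g"
      by (metis cblinfun_eqI cinner_right_cancel)
  qed
  from theI'[OF this] show ?thesis
    unfolding adjoint_cblinfun_def by blast
qed

section \<open>Bordering a Fredholm operator\<close>

text \<open>With respect to \<open>H = (ker T)\<^sup>\<bottom> \<oplus> ker T\<close> and \<open>H = ran T \<oplus> (ran T)\<^sup>\<bottom>\<close> this is the
  block diagonal operator with the invertible block of \<open>T\<close> and the compression of \<open>D\<close> to
  \<open>ker T \<rightarrow> (ran T)\<^sup>\<bottom>\<close>.\<close>

definition bordered :: "('a::chilbert_space \<Rightarrow>\<^sub>C\<^sub>L 'a) \<Rightarrow> ('a \<Rightarrow>\<^sub>C\<^sub>L 'a) \<Rightarrow> 'a \<Rightarrow>\<^sub>C\<^sub>L 'a"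
  where "bordered T D = T + Proj (orth_compl (range T)) o\<^sub>C\<^sub>L D o\<^sub>C\<^sub>L Proj (ker T)"

context
  fixes T D :: "'a::chilbert_space \<Rightarrow>\<^sub>C\<^sub>L 'a"
  assumes K: "compact_cblinfun (id_cblinfun - T)" and D: "compact_cblinfun D"
begin

private abbreviation (input) "P \<equiv> Proj (orth_compl (range T))"
private abbreviation (input) "Q \<equiv> Proj (ker T)"

private lemma R: "closed_csubspace (range T)"
  by (rule closed_csubspace_range_id_minus_compact[OF K])

private lemma P_T: "P (T x) = 0"
  by (rule Proj_eq_0) (simp_all add: orth_compl_orth_compl[OF R])

private lemma T_Q: "T (Q x) = 0"
  using Proj_in[OF closed_csubspace_ker, of T x] by (simp add: ker_def)

private lemma P_P: "P (P x) = P x"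
  by (simp add: Proj_fixes)

lemma compact_bordered: "compact_cblinfun (id_cblinfun - bordered T D)"
proof -
  have "id_cblinfun - bordered T D = (id_cblinfun - T) - P o\<^sub>C\<^sub>L D o\<^sub>C\<^sub>L Q"
    by (simp add: bordered_def)
  then show ?thesis
    by (simp only: K D compact_cblinfun_diff compact_cblinfun_compose_left
        compact_cblinfun_compose_right)
qed

lemma bordered_apply: "bordered T D x = T x + P (D (Q x))"
  by (simp add: bordered_def)

lemma bordered_apply_ker: "x \<in> ker T \<Longrightarrow> bordered T D x = P (D x)"
  by (simp add: bordered_apply Proj_fixes) (simp add: ker_def)

private lemma P_bordered: "P (bordered T D x) = P (D (Q x))"
  by (simp add: bordered_apply cblinfun_apply_add P_T P_P)

text \<open>The part of the value in \<open>ran T\<close> is \<open>T x\<close>, so it vanishes only on the kernel.\<close>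

lemma bordered_eq_imp_ker:
  assumes "P (bordered T D x) = bordered T D x"
  shows "x \<in> ker T"
  using assms P_bordered[of x] by (simp add: bordered_apply ker_def)

lemma ker_bordered: "ker (bordered T D) = {x \<in> ker T. P (D x) = 0}"
proof
  show "ker (bordered T D) \<subseteq> {x \<in> ker T. P (D x) = 0}"
  proof
    fix x assume x: "x \<in> ker (bordered T D)"
    then have "x \<in> ker T"
      by (intro bordered_eq_imp_ker) (simp add: ker_def)
    then show "x \<in> {x \<in> ker T. P (D x) = 0}"
      using x bordered_apply_ker[of x] by (simp add: ker_def)
  qed
  show "{x \<in> ker T. P (D x) = 0} \<subseteq> ker (bordered T D)"
    using bordered_apply_ker by (auto simp: ker_def)
qed

private lemma diff_P_in_range: "y - P y \<in> range T"
  using Proj_in[OF R, of y] by (simp add: Proj_orth_compl[OF R])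

text \<open>Modulo \<open>ran T\<close>, the projection on \<open>(ran T)\<^sup>\<bottom>\<close> is the identity.\<close>

lemma range_bordered: "range (bordered T D) = range T + D ` ker T"
proof (rule set_eqI, rule iffI)
  fix y assume "y \<in> range (bordered T D)"
  then obtain x where x: "y = T x + P (D (Q x))"
    by (auto simp: bordered_apply)
  have "T x - (D (Q x) - P (D (Q x))) \<in> range T"
    using closed_csubspaceD(6)[OF R _ diff_P_in_range] by blast
  moreover have "D (Q x) \<in> D ` ker T"
    by (intro imageI) simp
  moreover have "y = T x - (D (Q x) - P (D (Q x))) + D (Q x)"
    by (simp add: x)
  ultimately show "y \<in> range T + D ` ker T"
    by (metis set_plus_intro)
next
  fix y assume "y \<in> range T + D ` ker T"
  then obtain x n where y: "y = T x + D n" and n: "n \<in> ker T"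
    by (auto elim!: set_plus_elim)
  obtain u where u: "D n - P (D n) = T u"
    using diff_P_in_range[of "D n"] by auto
  have "bordered T D (x + u - Q (x + u) + n) = T x + T u + P (D n)"
    using n by (simp add: bordered_apply cblinfun_apply_add cblinfun_apply_diff T_Q Proj_fixes)
      (simp add: ker_def)
  also have "\<dots> = y"
    by (simp add: y u[symmetric])
  finally show "y \<in> range (bordered T D)"
    by blast
qed

lemma range_bordered_mono: "range T \<subseteq> range (bordered T D)"
proof
  fix y assume "y \<in> range T"
  moreover have "0 \<in> D ` ker T"
    using closed_csubspaceD(2)[OF closed_csubspace_ker] cblinfun_apply_zero[of D] by (metis imageI)
  ultimately show "y \<in> range (bordered T D)"
    unfolding range_bordered by (metis add.right_neutral set_plus_intro)
qed

text \<open>The bordered operator is bijective iff the compression of \<open>D\<close> is, and by the Fredholm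
  alternative it is bijective as soon as it is onto.\<close>

lemma bordered_surj_iff_bij:
  "range (bordered T D) = UNIV \<longleftrightarrow> bij_betw (P o\<^sub>C\<^sub>L D) (ker T) (orth_compl (range T))"
proof
  assume surj: "range (bordered T D) = UNIV"
  then have ker0: "ker (bordered T D) = {0}"
    by (rule id_minus_compact_surj_imp_inj[OF compact_bordered])
  show "bij_betw (P o\<^sub>C\<^sub>L D) (ker T) (orth_compl (range T))"
  proof (rule bij_betwI')
    fix x y assume "x \<in> ker T" "y \<in> ker T"
    moreover from this have "x - y \<in> ker T"
      by (intro closed_csubspaceD) simp_all
    ultimately have "x - y \<in> ker (bordered T D)" if "P (D x) = P (D y)"
      using that by (simp add: ker_bordered cblinfun_apply_diff)
    then show "((P o\<^sub>C\<^sub>L D) x = (P o\<^sub>C\<^sub>L D) y) = (x = y)"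
      by (auto simp: ker0)
  next
    fix y assume y: "y \<in> orth_compl (range T)"
    obtain x where x: "y = bordered T D x"
      using surj by blast
    have "P y = y"
      using y by (simp add: Proj_fixes)
    then have "x \<in> ker T"
      unfolding x by (rule bordered_eq_imp_ker)
    then show "\<exists>x\<in>ker T. y = (P o\<^sub>C\<^sub>L D) x"
      using x by (auto simp: bordered_apply_ker)
  qed simp
next
  assume bij: "bij_betw (P o\<^sub>C\<^sub>L D) (ker T) (orth_compl (range T))"
  have "y \<in> range (bordered T D)" for y
  proof -
    have "P y \<in> (P o\<^sub>C\<^sub>L D) ` ker T"
      using bij by (simp add: bij_betw_def)
    then obtain x where x: "x \<in> ker T" "P y = P (D x)"
      by auto
    have "(y - P y) - (D x - P (D x)) \<in> range T"
      by (rule closed_csubspaceD(6)[OF R diff_P_in_range diff_P_in_range])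
    then have "y - D x \<in> range T"
      by (simp add: x)
    then have "(y - D x) + D x \<in> range T + D ` ker T"
      using x(1) by (intro set_plus_intro) auto
    then show ?thesis
      by (simp add: range_bordered)
  qed
  then show "range (bordered T D) = UNIV"
    by auto
qed

lemma bordered_surj_imp_direct:
  assumes "range (bordered T D) = UNIV"
  shows "range T \<inter> D ` ker T = {0}"
proof -
  have ker0: "ker (bordered T D) = {0}"
    using id_minus_compact_surj_imp_inj[OF compact_bordered assms] .
  have "range T \<inter> D ` ker T \<subseteq> {0}"
  proof
    fix y assume y: "y \<in> range T \<inter> D ` ker T"
    obtain z where "y = T z"
      using IntD1[OF y] by (rule imageE)
    moreover obtain x where x: "y = D x" "x \<in> ker T"
      using IntD2[OF y] by (rule imageE)
    ultimately have "P (D x) = 0"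
      using P_T[of z] by simp
    then have "x \<in> ker (bordered T D)"
      using x(2) by (simp add: ker_bordered)
    then show "y \<in> {0}"
      using x(1) by (simp add: ker0)
  qed
  moreover have "0 \<in> range T" "0 \<in> D ` ker T"
    using closed_csubspaceD(2)[OF R] closed_csubspaceD(2)[OF closed_csubspace_ker, of T]
    by (simp_all, metis cblinfun_apply_zero imageI)
  ultimately show ?thesis
    by blast
qed

text \<open>The Moore--Penrose inverse of the compression of \<open>D\<close> is read off from the one of the
  bordered operator, since the latter is block diagonal.\<close>

lemma mp_inverse_compression:
  "mp_inverse (ker T) (orth_compl (range T)) (P o\<^sub>C\<^sub>L D) = mp_inverse UNIV UNIV (bordered T D) o\<^sub>C\<^sub>L P"
proof (rule mp_inverse_eqI)
  have image: "(P o\<^sub>C\<^sub>L D) ` ker T = range (bordered T D) \<inter> orth_compl (range T)"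
  proof
    show "(P o\<^sub>C\<^sub>L D) ` ker T \<subseteq> range (bordered T D) \<inter> orth_compl (range T)"
    proof (rule image_subsetI, rule IntI)
      fix x assume "x \<in> ker T"
      then show "(P o\<^sub>C\<^sub>L D) x \<in> range (bordered T D)"
        by (simp add: bordered_apply_ker[symmetric])
    qed simp
    show "range (bordered T D) \<inter> orth_compl (range T) \<subseteq> (P o\<^sub>C\<^sub>L D) ` ker T"
    proof
      fix y assume y: "y \<in> range (bordered T D) \<inter> orth_compl (range T)"
      then obtain x where x: "y = bordered T D x"
        by auto
      moreover have "P y = y"
        using y by (simp add: Proj_fixes)
      ultimately have "x \<in> ker T"
        using bordered_eq_imp_ker by simp
      then show "y \<in> (P o\<^sub>C\<^sub>L D) ` ker T"
        using x by (auto simp: bordered_apply_ker)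
    qed
  qed
  show "closed_csubspace ((P o\<^sub>C\<^sub>L D) ` ker T)"
    unfolding image
    by (intro closed_csubspace_Int closed_csubspace_range_id_minus_compact compact_bordered) simp
  show "(P o\<^sub>C\<^sub>L D) ` ker T \<subseteq> orth_compl (range T)"
    unfolding image by simp
  show "(mp_inverse UNIV UNIV (bordered T D) o\<^sub>C\<^sub>L P) y = 0"
    if y: "y \<in> orth_compl (range T)" "y \<in> orth_compl ((P o\<^sub>C\<^sub>L D) ` ker T)" for y
  proof -
    have "cinner y (bordered T D x) = 0" for x
      using y by (auto simp: bordered_apply orth_compl_def cinner_add_right)
    then have "mp_inverse UNIV UNIV (bordered T D) y = 0"
      by (intro mp_inverse_id_minus_compact(3)[OF compact_bordered]) (auto simp: orth_compl_def)
    then show ?thesis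
      using y(1) by (simp add: Proj_fixes)
  qed
  show "(mp_inverse UNIV UNIV (bordered T D) o\<^sub>C\<^sub>L P) ((P o\<^sub>C\<^sub>L D) x) = x"
    if x: "x \<in> ker T" "x \<in> orth_compl (ker T \<inter> ker (P o\<^sub>C\<^sub>L D))" for x
  proof -
    have "ker T \<inter> ker (P o\<^sub>C\<^sub>L D) = ker (bordered T D)"
      unfolding ker_bordered by (auto simp: ker_def)
    then have "Proj (ker (bordered T D)) x = 0"
      using x(2) by (simp add: Proj_eq_0)
    then have "mp_inverse UNIV UNIV (bordered T D) (bordered T D x) = x"
      by (simp add: mp_inverse_id_minus_compact(2)[OF compact_bordered])
    then show ?thesis
      using x(1) by (simp add: bordered_apply_ker P_P)
  qed
  show "(mp_inverse UNIV UNIV (bordered T D) o\<^sub>C\<^sub>L P) y = 0"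
    if "y \<in> orth_compl (orth_compl (range T))" for y
    using Proj_eq_0[OF closed_csubspace_orth_compl that] by simp
qed simp_all

text \<open>The rules for calculating with the Moore--Penrose inverse of the compression: it inverts the
  compression from either side, up to the projections on the cokernel and the kernel of the
  bordered operator.\<close>

lemma compression_mp_inverse:
  defines "L \<equiv> mp_inverse (ker T) (orth_compl (range T)) (P o\<^sub>C\<^sub>L D)"
  shows "L y \<in> ker T"
    and "P (D (L y)) = P y - Proj (orth_compl (range (bordered T D))) y"
    and "x \<in> ker T \<Longrightarrow> L (D x) = x - Proj (ker (bordered T D)) x"
    and "L (P y) = L y"
proof -
  let ?G = "mp_inverse UNIV UNIV (bordered T D)" and ?P1 = "Proj (orth_compl (range (bordered T D)))"
  have L: "L y = ?G (P y)" for y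
    by (simp add: L_def mp_inverse_compression)
  note R1 = closed_csubspace_range_id_minus_compact[OF compact_bordered]
  have P1_in: "?P1 y \<in> orth_compl (range T)" for y
    using orth_compl_antimono[OF range_bordered_mono] Proj_in[OF closed_csubspace_orth_compl] by blast
  have "y - P y \<in> orth_compl (orth_compl (range (bordered T D)))" for y
    using diff_P_in_range[of y] range_bordered_mono orth_compl_orth_compl[OF R1] by auto
  then have "?P1 (y - P y) = 0" for y
    by (intro Proj_eq_0) simp_all
  then have P1_P: "?P1 (P y) = ?P1 y" for y
    by (simp add: cblinfun_apply_diff)
  have T1: "bordered T D (L y) = P y - ?P1 y" for y
    by (simp add: L mp_inverse_id_minus_compact(1)[OF compact_bordered] P1_P)
  show L_ker: "L y \<in> ker T" for y
    by (rule bordered_eq_imp_ker)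
      (simp add: T1 cblinfun_apply_diff P_P Proj_fixes[OF _ P1_in])
  show "P (D (L y)) = P y - ?P1 y"
    using T1[of y] L_ker[of y] by (simp add: bordered_apply_ker)
  show "L (D x) = x - Proj (ker (bordered T D)) x" if "x \<in> ker T"
    using mp_inverse_id_minus_compact(2)[OF compact_bordered, of x] that
    by (simp add: L bordered_apply_ker)
  show "L (P y) = L y"
    by (simp add: L P_P)
qed

end

section \<open>Polynomial pencils: derivatives and Taylor coefficients\<close>

lemma cblinfun_compose_simps:
  "(A + B) o\<^sub>C\<^sub>L C = A o\<^sub>C\<^sub>L C + B o\<^sub>C\<^sub>L C" "(A - B) o\<^sub>C\<^sub>L C = A o\<^sub>C\<^sub>L C - B o\<^sub>C\<^sub>L C"
  "C' o\<^sub>C\<^sub>L (A + B) = C' o\<^sub>C\<^sub>L A + C' o\<^sub>C\<^sub>L B" "C' o\<^sub>C\<^sub>L (A - B) = C' o\<^sub>C\<^sub>L A - C' o\<^sub>C\<^sub>L B"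
  "(c *\<^sub>C A) o\<^sub>C\<^sub>L C = c *\<^sub>C (A o\<^sub>C\<^sub>L C)" "C' o\<^sub>C\<^sub>L (c *\<^sub>C A) = c *\<^sub>C (C' o\<^sub>C\<^sub>L A)"
  "0 o\<^sub>C\<^sub>L C = 0" "C' o\<^sub>C\<^sub>L 0 = 0" "A o\<^sub>C\<^sub>L id_cblinfun = A" "id_cblinfun o\<^sub>C\<^sub>L A = A"
  "(C' o\<^sub>C\<^sub>L A) o\<^sub>C\<^sub>L C = C' o\<^sub>C\<^sub>L (A o\<^sub>C\<^sub>L C)"
  by (rule cblinfun_eqI; simp add: cblinfun_apply_add cblinfun_apply_diff cblinfun_apply_scaleC)+

lemma cblinfun_compose_sum_left: "(\<Sum>i\<in>I. f i) o\<^sub>C\<^sub>L C = (\<Sum>i\<in>I. f i o\<^sub>C\<^sub>L C)"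
  by (induction I rule: infinite_finite_induct) (simp_all add: cblinfun_compose_simps)

lemma cblinfun_compose_sum_right: "C o\<^sub>C\<^sub>L (\<Sum>i\<in>I. f i) = (\<Sum>i\<in>I. C o\<^sub>C\<^sub>L f i)"
  by (induction I rule: infinite_finite_induct) (simp_all add: cblinfun_compose_simps)

lemma bounded_linear_scaleC_left: "bounded_linear (\<lambda>c. c *\<^sub>C (x :: 'a::complex_normed_vector))"
  by (rule bounded_linear_intro[of _ "norm x"])
    (simp_all add: scaleC_add_left scaleR_scaleC scaleC_scaleC norm_scaleC scaleC_complex_def)

lemma bounded_linear_compose_left: "bounded_linear (\<lambda>X. A o\<^sub>C\<^sub>L X)"
  by (rule bounded_linear_intro[of _ "norm A"])
    (simp_all add: cblinfun_compose_simps scaleR_scaleC norm_cblinfun_compose_le mult.commute[of "norm _" "norm A"])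

lemma cderiv_eqI:
  assumes "(F has_derivative (\<lambda>h. h *\<^sub>C D)) (at z)"
  shows "cderiv F z = D"
  unfolding cderiv_def
proof (rule the_equality[where P = "\<lambda>D. (F has_derivative (\<lambda>h. h *\<^sub>C D)) (at z)", OF assms])
  fix D' assume "(F has_derivative (\<lambda>h. h *\<^sub>C D')) (at z)"
  then have "(\<lambda>h. h *\<^sub>C D') = (\<lambda>h. h *\<^sub>C D)"
    using assms by (rule has_derivative_unique)
  from fun_cong[OF this, of 1] show "D' = D"
    by simp
qed

lemma has_derivative_power_scaleC:
  fixes B :: "'a::complex_normed_vector"
  shows "((\<lambda>z. (c * z ^ n) *\<^sub>C B) has_derivative (\<lambda>h. h *\<^sub>C (c * (of_nat n * z ^ (n - 1))) *\<^sub>C B)) (at z)"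
proof -
  have "((\<lambda>z. c * z ^ n) has_field_derivative c * (of_nat n * z ^ (n - 1))) (at z)"
    by (auto intro!: derivative_eq_intros)
  then have "((\<lambda>z. c * z ^ n) has_derivative (\<lambda>h. h * (c * (of_nat n * z ^ (n - 1))))) (at z)"
    by (simp add: has_field_derivative_def mult.commute[of _ "c * _"])
  from bounded_linear.has_derivative[OF bounded_linear_scaleC_left this, of B]
  show ?thesis
    by (simp add: scaleC_scaleC)
qed

text \<open>The falling factorial \<open>j (j - 1) \<dots> (j - k + 1)\<close> is written as \<open>k!\<close> times a binomial coefficient, to
  match the Taylor coefficients.\<close>

lemma funpow_cderiv_pencil:
  fixes B :: "nat \<Rightarrow> 'a::complex_normed_vector"
  shows "(cderiv ^^ k) (\<lambda>z. \<Sum>j\<le>p. z ^ j *\<^sub>C B j) =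
    (\<lambda>z. \<Sum>j\<le>p. (fact k * of_nat (j choose k) * z ^ (j - k)) *\<^sub>C B j)"
proof (induction k)
  case (Suc k)
  have choose: "fact k * of_nat (j choose k) * (of_nat (j - k) * z ^ (j - k - 1)) =
      fact (Suc k) * of_nat (j choose Suc k) * z ^ (j - Suc k)" for j and z :: complex
  proof -
    have "Suc k * (j choose Suc k) = (j - k) * (j choose k)"
      by (simp only: binomial_absorb_comp binomial_absorption)
    then have "of_nat (Suc k) * of_nat (j choose Suc k) = (of_nat (j - k) * of_nat (j choose k) :: complex)"
      by (metis of_nat_mult)
    then show ?thesis
      by (simp only: fact_Suc of_nat_mult diff_Suc_eq_diff_pred diff_diff_left Suc_eq_plus1[symmetric] mult_ac)
  qed
  have "cderiv (\<lambda>z. \<Sum>j\<le>p. (fact k * of_nat (j choose k) * z ^ (j - k)) *\<^sub>C B j) z =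
    (\<Sum>j\<le>p. (fact (Suc k) * of_nat (j choose Suc k) * z ^ (j - Suc k)) *\<^sub>C B j)" for z
  proof (rule cderiv_eqI)
    have "((\<lambda>z. \<Sum>j\<le>p. (fact k * of_nat (j choose k) * z ^ (j - k)) *\<^sub>C B j) has_derivative
      (\<lambda>h. \<Sum>j\<le>p. h *\<^sub>C (fact k * of_nat (j choose k) * (of_nat (j - k) * z ^ (j - k - 1))) *\<^sub>C B j)) (at z)"
      by (intro has_derivative_sum has_derivative_power_scaleC)
    then show "((\<lambda>z. \<Sum>j\<le>p. (fact k * of_nat (j choose k) * z ^ (j - k)) *\<^sub>C B j) has_derivative
      (\<lambda>h. h *\<^sub>C (\<Sum>j\<le>p. (fact (Suc k) * of_nat (j choose Suc k) * z ^ (j - Suc k)) *\<^sub>C B j))) (at z)"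
      unfolding choose scaleC_sum_right .
  qed
  then show ?case
    using Suc by auto
qed simp

lemma pencil_Taylor:
  fixes B :: "nat \<Rightarrow> 'a::complex_vector"
  shows "(\<Sum>j\<le>p. z ^ j *\<^sub>C B j) = (\<Sum>k\<le>p. (z - w) ^ k *\<^sub>C (\<Sum>j\<le>p. (of_nat (j choose k) * w ^ (j - k)) *\<^sub>C B j))"
proof -
  have "z ^ j = (\<Sum>k\<le>p. (z - w) ^ k * (of_nat (j choose k) * w ^ (j - k)))" if "j \<le> p" for j
  proof -
    have "z ^ j = ((z - w) + w) ^ j"
      by simp
    also have "\<dots> = (\<Sum>k\<le>j. of_nat (j choose k) * (z - w) ^ k * w ^ (j - k))"
      by (rule binomial_ring)
    also have "\<dots> = (\<Sum>k\<le>p. of_nat (j choose k) * (z - w) ^ k * w ^ (j - k))"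
      using that by (intro sum.mono_neutral_left) (auto simp: binomial_eq_0)
    finally show ?thesis
      by (simp add: mult_ac)
  qed
  then have "(\<Sum>j\<le>p. z ^ j *\<^sub>C B j) =
    (\<Sum>j\<le>p. \<Sum>k\<le>p. ((z - w) ^ k * (of_nat (j choose k) * w ^ (j - k))) *\<^sub>C B j)"
    by (simp add: scaleC_sum_left)
  also have "\<dots> = (\<Sum>k\<le>p. (z - w) ^ k *\<^sub>C (\<Sum>j\<le>p. (of_nat (j choose k) * w ^ (j - k)) *\<^sub>C B j))"
    by (subst sum.swap) (simp add: scaleC_sum_right scaleC_scaleC)
  finally show ?thesis .
qed

section \<open>Power series with operator coefficients\<close>

text \<open>The coefficients of the product of two power series.\<close>

definition conv ::
  "(nat \<Rightarrow> 'a::complex_normed_vector \<Rightarrow>\<^sub>C\<^sub>L 'a) \<Rightarrow> (nat \<Rightarrow> 'a \<Rightarrow>\<^sub>C\<^sub>L 'a) \<Rightarrow> nat \<Rightarrow> 'a \<Rightarrow>\<^sub>C\<^sub>L 'a"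
  where "conv A T n = (\<Sum>i=0..n. A i o\<^sub>C\<^sub>L T (n - i))"

lemma conv_assoc: "conv A (conv B C) n = conv (conv A B) C n"
proof -
  have "conv (conv A B) C n = (\<Sum>j=0..n. \<Sum>i=0..j. A i o\<^sub>C\<^sub>L (B (j - i) o\<^sub>C\<^sub>L C (n - j)))"
    by (simp add: conv_def cblinfun_compose_sum_left cblinfun_compose_simps)
  also have "\<dots> = (\<Sum>j=0..n. \<Sum>i=0..n - j. A j o\<^sub>C\<^sub>L (B i o\<^sub>C\<^sub>L C (n - j - i)))"
    by (rule fps_mult_assoc_lemma)
  finally show ?thesis
    by (simp add: conv_def cblinfun_compose_sum_right)
qed

text \<open>Since one factor is a polynomial, the Cauchy product needs only finitely many shifts of the given
  series, and no absolute convergence.\<close>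

lemma conv_sums:
  assumes T: "(\<lambda>n. w ^ n *\<^sub>C T n) sums S" and A: "\<And>k. k > p \<Longrightarrow> A k = 0"
  shows "(\<lambda>n. w ^ n *\<^sub>C conv A T n) sums ((\<Sum>k\<le>p. w ^ k *\<^sub>C A k) o\<^sub>C\<^sub>L S)"
proof -
  define f where "f k n = (if n < k then 0 else w ^ n *\<^sub>C (A k o\<^sub>C\<^sub>L T (n - k)))" for k n
  have "f k sums (w ^ k *\<^sub>C A k o\<^sub>C\<^sub>L S)" for k
  proof -
    have "(\<lambda>n. (w ^ k *\<^sub>C A k) o\<^sub>C\<^sub>L (w ^ n *\<^sub>C T n)) sums (w ^ k *\<^sub>C A k o\<^sub>C\<^sub>L S)"
      by (rule bounded_linear.sums[OF bounded_linear_compose_left T])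
    moreover have "(w ^ k *\<^sub>C A k) o\<^sub>C\<^sub>L (w ^ n *\<^sub>C T n) = f k (n + k)" for n
      by (simp add: f_def cblinfun_compose_simps scaleC_scaleC power_add mult.commute)
    ultimately have "(\<lambda>n. f k (n + k)) sums (w ^ k *\<^sub>C A k o\<^sub>C\<^sub>L S)"
      by simp
    then show ?thesis
      by (subst (asm) sums_zero_iff_shift) (simp_all add: f_def)
  qed
  then have "(\<lambda>n. \<Sum>k\<le>p. f k n) sums (\<Sum>k\<le>p. w ^ k *\<^sub>C A k o\<^sub>C\<^sub>L S)"
    by (rule sums_sum)
  moreover have "(\<Sum>k\<le>p. f k n) = w ^ n *\<^sub>C conv A T n" for n
  proof -
    have "(\<Sum>k\<le>p. f k n) = (\<Sum>k\<le>max p n. f k n)"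
      using A by (intro sum.mono_neutral_left) (auto simp: f_def cblinfun_compose_simps)
    also have "\<dots> = (\<Sum>k=0..n. f k n)"
      by (intro sum.mono_neutral_right) (auto simp: f_def)
    also have "\<dots> = w ^ n *\<^sub>C conv A T n"
      by (simp add: conv_def f_def scaleC_sum_right)
    finally show ?thesis .
  qed
  ultimately show ?thesis
    by (simp add: cblinfun_compose_sum_left)
qed

text \<open>After division by a power of \<open>w\<close>, the first nonzero coefficient is minus the sum of the remaining
  terms, which tends to \<open>0\<close> with \<open>w\<close>.\<close>

lemma power_series_unique:
  fixes C :: "nat \<Rightarrow> 'a::{complex_normed_vector, banach}"
  assumes "r > 0" and C: "\<And>w. 0 < cmod w \<Longrightarrow> cmod w < r \<Longrightarrow> (\<lambda>n. w ^ n *\<^sub>C C n) sums 0"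
  shows "C n = 0"
proof (induction n rule: less_induct)
  case (less n)
  have tail: "(\<lambda>k. w ^ k *\<^sub>C C (k + n)) sums 0" if w: "0 < cmod w" "cmod w < r" for w
  proof -
    have "(\<lambda>k. w ^ (k + n) *\<^sub>C C (k + n)) sums 0"
      using C[OF w] less by (subst sums_zero_iff_shift) auto
    moreover have "inverse (w ^ n) * w ^ (k + n) = w ^ k" for k
      using w by (simp add: power_add)
    ultimately show ?thesis
      using bounded_linear.sums[OF bounded_linear_scaleC_right, of _ 0 "inverse (w ^ n)"]
      by (fastforce simp: scaleC_scaleC)
  qed
  show ?case
  proof (rule ccontr)
    assume Cn: "C n \<noteq> 0"
    define \<rho> where "\<rho> = r / 2"
    have \<rho>: "0 < \<rho>" "\<rho> < r"
      using \<open>r > 0\<close> by (simp_all add: \<rho>_def)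
    have "summable (\<lambda>k. complex_of_real \<rho> ^ k *\<^sub>C C (k + n))"
      using tail[of "complex_of_real \<rho>"] \<rho> by (auto simp: summable_def)
    then have "Bseq (\<lambda>k. complex_of_real \<rho> ^ k *\<^sub>C C (k + n))"
      by (intro convergent_imp_Bseq convergentI[OF summable_LIMSEQ_zero])
    then obtain M where M: "M > 0" "\<And>k. norm (complex_of_real \<rho> ^ k *\<^sub>C C (k + n)) \<le> M"
      by (auto simp: Bseq_def)
    then have M': "\<rho> ^ k * norm (C (k + n)) \<le> M" for k
      using M(2)[of k] \<rho> by (simp add: norm_scaleC norm_power)
    \<comment> \<open>At distance \<open>\<rho>t\<close> from the centre the terms after the first sum to at most \<open>2Mt\<close>.\<close>
    define t where "t = norm (C n) / (4 * M)"
    have t: "0 < t" "t \<le> 1 / 4"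
      using M(1) Cn M'[of 0] by (simp_all add: t_def field_simps)
    let ?w = "complex_of_real (\<rho> * t)"
    have "\<rho> * t < \<rho> * 1"
      using \<rho> t by (intro mult_strict_left_mono) simp_all
    then have "\<rho> * t < r"
      using \<rho> by linarith
    then have w: "0 < cmod ?w" "cmod ?w < r"
      using \<rho> t by (simp_all add: norm_mult)
    have "(\<lambda>k. ?w ^ Suc k *\<^sub>C C (Suc k + n)) sums (0 - C n)"
      using sums_split_initial_segment[OF tail[OF w], of 1] by simp
    moreover have "(\<lambda>k. M * t * t ^ k) sums (M * t * (1 / (1 - t)))"
      using t by (intro sums_mult geometric_sums) simp
    moreover have "norm (?w ^ Suc k *\<^sub>C C (Suc k + n)) \<le> M * t * t ^ k" for k
    proof -
      have "norm (?w ^ Suc k *\<^sub>C C (Suc k + n)) = t ^ Suc k * (\<rho> ^ Suc k * norm (C (Suc k + n)))"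
        using \<rho> t by (simp add: norm_scaleC norm_mult norm_power power_mult_distrib)
      also have "\<dots> \<le> t ^ Suc k * M"
        using t by (intro mult_left_mono M') simp_all
      finally show ?thesis
        by (simp add: mult_ac)
    qed
    ultimately have "norm (0 - C n) \<le> M * t * (1 / (1 - t))"
      by (rule norm_sums_le)
    also have "\<dots> \<le> M * t * 2"
      using t M(1) by (intro mult_left_mono) (simp_all add: field_simps)
    also have "\<dots> = norm (C n) / 2"
      using M(1) by (simp add: t_def)
    finally show False
      using Cn by simp
  qed
qed

section \<open>Laurent series of the inverse of a pencil\<close>

lemma is_inverse_cblinfun_unique:
  assumes "is_inverse_cblinfun A B"
  shows "inverse_cblinfun A = B"
  unfolding inverse_cblinfun_def
proof (rule the_equality)
  fix B' assume "is_inverse_cblinfun A B'"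
  then have "B' = B' o\<^sub>C\<^sub>L (A o\<^sub>C\<^sub>L B)" "(B' o\<^sub>C\<^sub>L A) o\<^sub>C\<^sub>L B = B"
    using assms by (simp_all add: is_inverse_cblinfun_def cblinfun_compose_simps)
  then show "B' = B"
    by (simp add: cblinfun_compose_simps)
qed (rule assms)

lemma invertible_imp_is_inverse: "invertible_cblinfun A \<Longrightarrow> is_inverse_cblinfun A (inverse_cblinfun A)"
  using is_inverse_cblinfun_unique by (metis invertible_cblinfun_def)

lemma sums_single_coefficient:
  fixes X :: "'a::complex_normed_vector"
  shows "(\<lambda>n. w ^ n *\<^sub>C (if n = d then X else 0)) sums (w ^ d *\<^sub>C X)"
proof -
  have "(\<lambda>n. w ^ n *\<^sub>C (if n = d then X else 0)) = (\<lambda>n. if n = d then w ^ n *\<^sub>C X else 0)"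
    by (rule ext) simp
  then show ?thesis
    using sums_single[of d "\<lambda>n. w ^ n *\<^sub>C X"] by simp
qed

context
  fixes F :: "complex \<Rightarrow> 'a::chilbert_space \<Rightarrow>\<^sub>C\<^sub>L 'a" and A :: "nat \<Rightarrow> 'a \<Rightarrow>\<^sub>C\<^sub>L 'a"
    and z0 :: complex and p :: nat
  assumes F: "F z = (\<Sum>k\<le>p. (z - z0) ^ k *\<^sub>C A k)" and A: "k > p \<Longrightarrow> A k = 0"
begin

text \<open>Multiplied by \<open>(z - z0)\<^sup>d\<close>, the product of \<open>F z\<close> and its inverse is a power series whose sum is a
  multiple of the identity; coefficients are compared by uniqueness.\<close>

lemma laurent_coefficients:
  assumes "inverse_has_laurent_series F z0 d \<Upsilon>"
  shows "conv A (\<lambda>n. \<Upsilon> (int n - int d)) n = (if n = d then id_cblinfun else 0)"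
proof -
  let ?T = "\<lambda>n. \<Upsilon> (int n - int d)" and ?I = "\<lambda>n. if n = d then id_cblinfun else 0 :: 'a \<Rightarrow>\<^sub>C\<^sub>L 'a"
  obtain r where r: "r > 0" "\<And>z. 0 < cmod (z - z0) \<Longrightarrow> cmod (z - z0) < r \<Longrightarrow>
      invertible_cblinfun (F z) \<and> (\<lambda>n. (z - z0) powi (int n - int d) *\<^sub>C ?T n) sums inverse_cblinfun (F z)"
    using assms by (auto simp: inverse_has_laurent_series_def)
  have "conv A ?T n - ?I n = 0"
  proof (rule power_series_unique[where C = "\<lambda>n. conv A ?T n - ?I n", OF r(1)])
    fix w :: complex assume w: "0 < cmod w" "cmod w < r"
    let ?G = "inverse_cblinfun (F (z0 + w))"
    have inv: "F (z0 + w) o\<^sub>C\<^sub>L ?G = id_cblinfun"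
      and sums: "(\<lambda>n. w powi (int n - int d) *\<^sub>C ?T n) sums ?G"
      using r(2)[of "z0 + w"] w invertible_imp_is_inverse by (auto simp: is_inverse_cblinfun_def)
    have "w ^ d * w powi (int n - int d) = w ^ n" for n
      using w by (simp add: power_int_diff)
    then have "(\<lambda>n. w ^ n *\<^sub>C ?T n) sums (w ^ d *\<^sub>C ?G)"
      using bounded_linear.sums[OF bounded_linear_scaleC_right sums, of "w ^ d"]
      by (simp add: scaleC_scaleC)
    from conv_sums[OF this A]
    have "(\<lambda>n. w ^ n *\<^sub>C conv A ?T n) sums (F (z0 + w) o\<^sub>C\<^sub>L (w ^ d *\<^sub>C ?G))"
      by (simp add: F)
    then have "(\<lambda>n. w ^ n *\<^sub>C conv A ?T n) sums (w ^ d *\<^sub>C id_cblinfun)"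
      by (simp add: cblinfun_compose_simps inv)
    from sums_diff[OF this sums_single_coefficient[of w d id_cblinfun]]
    show "(\<lambda>n. w ^ n *\<^sub>C (conv A ?T n - ?I n)) sums 0"
      by (simp add: scaleC_diff_right)
  qed
  then show ?thesis
    by simp
qed

text \<open>A right inverse modulo higher order terms, \<open>A * R = z\<^sup>d (I + E)\<close> with \<open>E\<close> vanishing at
  the centre, is corrected to an exact one by the power series \<open>R (I + E)\<^sup>-\<^sup>1\<close>. This series \<open>T\<close>
  is obtained by solving \<open>T = R - T * E\<close> recursively, and its coefficients grow at most
  geometrically. A right inverse of \<open>F z\<close> is an inverse by the Fredholm alternative.\<close>

lemma right_parametrix_imp_laurent:
  assumes compact: "\<And>z. compact_cblinfun (id_cblinfun - F z)"
    and R0: "\<And>n. n > d \<Longrightarrow> R n = 0"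
    and R: "\<And>n. n \<le> d \<Longrightarrow> conv A R n = (if n = d then id_cblinfun else 0)"
  shows "\<exists>\<Upsilon>. inverse_has_laurent_series F z0 d \<Upsilon> \<and> \<Upsilon> (- int d) = R 0"
proof -
  define E where "E n = (if n = 0 then 0 else conv A R (d + n))" for n
  define M where "M = (\<Sum>n\<le>p. norm (E n))"
  define c where "c = (\<Sum>n\<le>d. norm (R n))"
  have M: "norm (E n) \<le> M" for n
  proof (cases "n \<le> p")
    case False
    have "A i o\<^sub>C\<^sub>L R (d + n - i) = 0" for i
      using False A[of i] R0[of "d + n - i"] by (cases "i > p") (simp_all add: cblinfun_compose_simps)
    then have "E n = 0"
      by (simp add: E_def conv_def)
    then show ?thesis
      by (simp add: M_def sum_nonneg)
  qed (auto simp: M_def intro: member_le_sum)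
  have M0: "M \<ge> 0"
    using M[of 0] norm_ge_zero order_trans by blast
  have c: "norm (R n) \<le> c" for n
    using R0[of n] by (cases "n \<le> d") (auto simp: c_def intro: member_le_sum sum_nonneg)
  have c0: "c \<ge> 0"
    using c[of 0] norm_ge_zero order_trans by blast
  \<comment> \<open>Then \<open>(A * T) (I + E) = A * R = z\<^sup>d (I + E)\<close>, and hence \<open>A * T = z\<^sup>d\<close>.\<close>
  define T where "T = wfrec less_than (\<lambda>T n. R n - (\<Sum>m<n. T m o\<^sub>C\<^sub>L E (n - m)))"
  have T: "T n = R n - (\<Sum>m<n. T m o\<^sub>C\<^sub>L E (n - m))" for n
    unfolding T_def by (subst wfrec[OF wf_less_than]) (simp add: cut_apply)
  have T_conv: "T n = R n - conv T E n" for n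
  proof -
    have "conv T E n = (\<Sum>m<n. T m o\<^sub>C\<^sub>L E (n - m))"
      unfolding conv_def
      by (intro sum.mono_neutral_right) (auto simp: E_def cblinfun_compose_simps)
    then show ?thesis
      using T[of n] by simp
  qed
  have growth: "norm (T n) \<le> c * (M + 1) ^ n" for n
  proof (induction n rule: less_induct)
    case (less n)
    have "norm (T n) \<le> norm (R n) + (\<Sum>m<n. norm (T m o\<^sub>C\<^sub>L E (n - m)))"
      unfolding T[of n] by (rule order_trans[OF norm_triangle_ineq4 add_left_mono[OF norm_sum]])
    also have "\<dots> \<le> c + (\<Sum>m<n. c * (M + 1) ^ m * M)"
    proof (intro add_mono c sum_mono)
      fix m assume "m \<in> {..<n}"
      then show "norm (T m o\<^sub>C\<^sub>L E (n - m)) \<le> c * (M + 1) ^ m * M"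
        using less M M0 c0
        by (intro order_trans[OF norm_cblinfun_compose_le] mult_mono) auto
    qed
    also have "\<dots> = c * (1 + M * (\<Sum>m<n. (M + 1) ^ m))"
      by (simp add: sum_distrib_left distrib_left mult_ac)
    also have "M * (\<Sum>m<n. (M + 1) ^ m) = (M + 1) ^ n - 1"
      using power_diff_1_eq[of "M + 1" n] by simp
    finally show ?case
      by simp
  qed
  have AT: "conv A T n = (if n = d then id_cblinfun else 0)" for n
  proof (induction n rule: less_induct)
    case (less n)
    have "conv A T n = (\<Sum>i=0..n. A i o\<^sub>C\<^sub>L (R (n - i) - conv T E (n - i)))"
      unfolding conv_def[of A T] by (simp add: T_conv[symmetric])
    also have "\<dots> = conv A R n - conv A (conv T E) n"
      by (simp add: conv_def[of A] cblinfun_compose_simps sum_subtractf)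
    also have "conv A (conv T E) n = (\<Sum>i=0..n. conv A T i o\<^sub>C\<^sub>L E (n - i))"
      by (simp only: conv_assoc) (simp add: conv_def[of "conv A T"])
    also have "\<dots> = (\<Sum>i<n. conv A T i o\<^sub>C\<^sub>L E (n - i))"
      by (intro sum.mono_neutral_right) (auto simp: E_def cblinfun_compose_simps)
    also have "\<dots> = (\<Sum>i<n. if i = d then E (n - i) else 0)"
      by (intro sum.cong) (simp_all add: less cblinfun_compose_simps)
    also have "\<dots> = (if d < n then E (n - d) else 0)"
      by simp
    also have "conv A R n - \<dots> = (if n = d then id_cblinfun else 0)"
      using R[of n] by (auto simp: E_def)
    finally show ?case .
  qed
  define \<Upsilon> where "\<Upsilon> k = T (nat (k + int d))" for k
  have "invertible_cblinfun (F z) \<and>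
      (\<lambda>n. (z - z0) powi (int n - int d) *\<^sub>C \<Upsilon> (int n - int d)) sums inverse_cblinfun (F z)"
    if z: "0 < cmod (z - z0)" "cmod (z - z0) < 1 / (M + 1)" for z
  proof -
    define w where "w = z - z0"
    have w: "w \<noteq> 0" "cmod w * (M + 1) < 1"
      using z M0 by (auto simp: w_def field_simps)
    have "summable (\<lambda>n. c * (cmod w * (M + 1)) ^ n)"
      using w M0 by (intro summable_mult summable_geometric) simp
    then have "summable (\<lambda>n. w ^ n *\<^sub>C T n)"
    proof (rule summable_comparison_test'[where N = 0])
      fix n
      have "norm (w ^ n *\<^sub>C T n) \<le> cmod w ^ n * (c * (M + 1) ^ n)"
        unfolding norm_scaleC norm_power using growth by (intro mult_left_mono) simp_all
      then show "norm (w ^ n *\<^sub>C T n) \<le> c * (cmod w * (M + 1)) ^ n"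
        by (simp add: power_mult_distrib mult_ac)
    qed
    then obtain S where S: "(\<lambda>n. w ^ n *\<^sub>C T n) sums S"
      by (auto simp: summable_def)
    define G where "G = inverse (w ^ d) *\<^sub>C S"
    have "F z o\<^sub>C\<^sub>L S = w ^ d *\<^sub>C id_cblinfun"
    proof (rule sums_unique2)
      show "(\<lambda>n. w ^ n *\<^sub>C conv A T n) sums (F z o\<^sub>C\<^sub>L S)"
        using conv_sums[OF S, of p A] A by (simp add: F w_def)
      show "(\<lambda>n. w ^ n *\<^sub>C conv A T n) sums (w ^ d *\<^sub>C id_cblinfun)"
        unfolding AT by (rule sums_single_coefficient)
    qed
    then have FG: "F z o\<^sub>C\<^sub>L G = id_cblinfun"
      using w by (simp add: G_def cblinfun_compose_simps scaleC_scaleC)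
    have FG_apply: "F z (G x) = x" for x
      using arg_cong[OF FG, of "\<lambda>X. X x"] by simp
    then have "range (F z) = UNIV"
      by (metis surjI)
    then have ker: "ker (F z) = {0}"
      by (rule id_minus_compact_surj_imp_inj[OF compact])
    have "G (F z x) = x" for x
    proof -
      have "G (F z x) - x \<in> ker (F z)"
        by (simp add: ker_def cblinfun_apply_diff FG_apply)
      then show ?thesis
        by (simp add: ker)
    qed
    then have "is_inverse_cblinfun (F z) G"
      using FG by (auto simp: is_inverse_cblinfun_def intro!: cblinfun_eqI)
    then have "invertible_cblinfun (F z)" "inverse_cblinfun (F z) = G"
      by (auto simp: invertible_cblinfun_def is_inverse_cblinfun_unique)
    moreover have "w powi (int n - int d) *\<^sub>C \<Upsilon> (int n - int d) = inverse (w ^ d) *\<^sub>C w ^ n *\<^sub>C T n" for n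
      using w by (simp add: \<Upsilon>_def power_int_diff scaleC_scaleC field_simps)
    ultimately show ?thesis
      using bounded_linear.sums[OF bounded_linear_scaleC_right S, of "inverse (w ^ d)"]
      by (simp add: G_def w_def)
  qed
  then have "inverse_has_laurent_series F z0 d \<Upsilon>"
    unfolding inverse_has_laurent_series_def using M0
    by (intro exI[of _ "1 / (M + 1)"]) auto
  moreover have "\<Upsilon> (- int d) = R 0"
    using T[of 0] by (simp add: \<Upsilon>_def)
  ultimately show ?thesis
    by blast
qed

end

section \<open>Poles of order at most two\<close>

lemma conv_low_order:
  "conv A T 0 = A 0 o\<^sub>C\<^sub>L T 0"
  "conv A T 1 = A 0 o\<^sub>C\<^sub>L T 1 + A 1 o\<^sub>C\<^sub>L T 0"
  "conv A T 2 = A 0 o\<^sub>C\<^sub>L T 2 + A 1 o\<^sub>C\<^sub>L T 1 + A 2 o\<^sub>C\<^sub>L T 0"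
  "conv A T 3 = A 0 o\<^sub>C\<^sub>L T 3 + A 1 o\<^sub>C\<^sub>L T 2 + A 2 o\<^sub>C\<^sub>L T 1 + A 3 o\<^sub>C\<^sub>L T 0"
  by (simp_all add: conv_def numeral_2_eq_2 numeral_3_eq_3 sum.atLeast0_atMost_Suc add.assoc)

text \<open>The simplifier should not turn \<open>A 1\<close> into \<open>A (Suc 0)\<close>.\<close>

declare One_nat_def [simp del]

text \<open>\<open>A k\<close> are the Taylor coefficients at \<open>z0\<close> of a polynomial pencil \<open>F\<close> of operators \<open>I - K\<close>.\<close>

locale compact_pencil =
  fixes F :: "complex \<Rightarrow> 'a::chilbert_space \<Rightarrow>\<^sub>C\<^sub>L 'a" and A :: "nat \<Rightarrow> 'a \<Rightarrow>\<^sub>C\<^sub>L 'a"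
    and z0 :: complex and p :: nat
  assumes expansion: "F z = (\<Sum>k\<le>p. (z - z0) ^ k *\<^sub>C A k)"
    and coeff_zero: "k > p \<Longrightarrow> A k = 0"
    and compact_F: "compact_cblinfun (id_cblinfun - F z)"
    and compact_coeff: "k \<ge> 1 \<Longrightarrow> compact_cblinfun (A k)"
begin

text \<open>With \<open>F = \<Phi>\<close> and \<open>z0 = 1\<close>, in the notation of the theorem, \<open>G = \<Pi>\<^sub>0\<^sup>+\<close>, \<open>S2 = \<Pi>\<^sub>2\<close>, \<open>S3 = \<Pi>\<^sub>3\<close>, and \<open>L\<close> is
  \<open>\<Lambda>\<^sub>1\<^sup>+\<close> extended by \<open>0\<close>. The operators \<open>T1\<close> and \<open>T2\<close> arise by bordering once and twice; \<open>P2\<close> is the projection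
  on \<open>\<alpha>\<^sub>2\<^sup>\<bottom>\<close> and \<open>Q2\<close> the one on \<open>\<beta>\<^sub>2\<^sup>\<bottom>\<close>.\<close>

abbreviation "N0 \<equiv> ker (A 0)"
abbreviation "G \<equiv> mp_inverse UNIV UNIV (A 0)"
abbreviation "P \<equiv> Proj (orth_compl (range (A 0)))"
abbreviation "Q \<equiv> Proj N0"
abbreviation "L \<equiv> mp_inverse N0 (orth_compl (range (A 0))) (P o\<^sub>C\<^sub>L A 1)"
abbreviation "T1 \<equiv> bordered (A 0) (A 1)"
abbreviation "P2 \<equiv> Proj (orth_compl (range T1))"
abbreviation "Q2 \<equiv> Proj (ker T1)"
abbreviation "S2 \<equiv> A 2 - A 1 o\<^sub>C\<^sub>L G o\<^sub>C\<^sub>L A 1"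
abbreviation "S3 \<equiv> A 3 - A 1 o\<^sub>C\<^sub>L G o\<^sub>C\<^sub>L A 1 o\<^sub>C\<^sub>L G o\<^sub>C\<^sub>L A 1"
abbreviation "T2 \<equiv> bordered T1 S2"

lemma F_centre: "F z0 = A 0"
proof -
  have "(\<Sum>k\<le>p. (z0 - z0) ^ k *\<^sub>C A k) = (\<Sum>k\<le>p. if k = 0 then A k else 0)"
    by (intro sum.cong) (auto simp: power_0_left)
  then show ?thesis
    by (simp add: expansion)
qed

lemma compact_A0: "compact_cblinfun (id_cblinfun - A 0)"
  using compact_F[of z0] by (simp add: F_centre)

lemma compact_A1: "compact_cblinfun (A 1)"
  by (rule compact_coeff) simp

lemma compact_T1: "compact_cblinfun (id_cblinfun - T1)"
  by (rule compact_bordered[OF compact_A0 compact_A1])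

lemma compact_S2: "compact_cblinfun S2"
  by (intro compact_cblinfun_diff compact_coeff compact_cblinfun_compose_left) simp_all

lemma A0_G: "A 0 (G y) = y - P y"
  and G_A0: "G (A 0 x) = x - Q x"
  by (rule mp_inverse_id_minus_compact[OF compact_A0])+

lemma P_A0: "P (A 0 x) = 0"
  by (rule Proj_eq_0)
    (simp_all add: orth_compl_orth_compl[OF closed_csubspace_range_id_minus_compact[OF compact_A0]])

lemma L_in: "L y \<in> N0"
  and P_A1_L: "P (A 1 (L y)) = P y - P2 y"
  and L_P: "L (P y) = L y"
  and L_A1: "x \<in> N0 \<Longrightarrow> L (A 1 x) = x - Q2 x"
  by (rule compression_mp_inverse[OF compact_A0 compact_A1]; assumption?)+

lemma A0_L: "A 0 (L y) = 0"
  using L_in[of y] by (simp add: ker_def)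

lemma ker_T1: "x \<in> ker T1 \<longleftrightarrow> x \<in> N0 \<and> P (A 1 x) = 0"
  using ker_bordered[OF compact_A0 compact_A1] by simp

lemma P2_range_T1: "y \<in> range T1 \<Longrightarrow> P2 y = 0"
  by (rule Proj_eq_0)
    (simp_all add: orth_compl_orth_compl[OF closed_csubspace_range_id_minus_compact[OF compact_T1]])

lemma P2_A0: "P2 (A 0 x) = 0"
  using range_bordered_mono[OF compact_A0 compact_A1] by (intro P2_range_T1) blast

lemma P2_A1: "x \<in> N0 \<Longrightarrow> P2 (A 1 x) = 0"
proof (rule P2_range_T1)
  assume "x \<in> N0"
  then have "A 0 0 + A 1 x \<in> range (A 0) + A 1 ` N0"
    by (intro set_plus_intro) blast+
  then show "A 1 x \<in> range T1"
    by (simp add: range_bordered[OF compact_A0 compact_A1])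
qed

lemma Q2_Q: "Q2 (Q x) = Q2 x"
proof -
  have "ker T1 \<subseteq> N0"
    using ker_T1 by blast
  then have "x - Q x \<in> orth_compl (ker T1)"
    using orth_compl_antimono Proj_orth[OF closed_csubspace_ker] by blast
  then have "Q2 (x - Q x) = 0"
    by (simp add: Proj_eq_0)
  then show ?thesis
    by (simp add: cblinfun_apply_diff)
qed

text \<open>The equations \<open>A 0 R\<^sub>0 = 0\<close> and \<open>A 0 R\<^sub>1 + A 1 R\<^sub>0 = I\<close> of a simple pole are solved by
  \<open>R\<^sub>0 = L\<close>, because then \<open>I - A 1 R\<^sub>0\<close> takes values in \<open>ran (A 0)\<close>.\<close>

lemma simple_pole_laurent:
  assumes "range T1 = UNIV"
  shows "\<exists>\<Upsilon>. inverse_has_laurent_series F z0 1 \<Upsilon> \<and> \<Upsilon> (- 1) = L"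
proof -
  define R where "R n = (if n = 0 then L else if n = 1 then G o\<^sub>C\<^sub>L (id_cblinfun - A 1 o\<^sub>C\<^sub>L L) else 0)" for n :: nat
  have P2_0: "P2 y = 0" for y
    using assms by (intro P2_range_T1) simp
  have "A 0 (R 0 y) = 0" for y
    by (simp add: R_def A0_L)
  moreover have "A 0 (R 1 y) + A 1 (R 0 y) = y" for y
    by (simp add: R_def A0_G cblinfun_apply_diff P_A1_L P2_0)
  moreover have "n = 0 \<or> n = 1" if "n \<le> 1" for n :: nat
    using that by linarith
  ultimately have conv: "conv A R n = (if n = 1 then id_cblinfun else 0)" if "n \<le> 1" for n
    using that by (fastforce simp: conv_low_order intro!: cblinfun_eqI)
  have "\<exists>\<Upsilon>. inverse_has_laurent_series F z0 1 \<Upsilon> \<and> \<Upsilon> (- int 1) = R 0"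
    by (rule right_parametrix_imp_laurent[OF expansion _ compact_F _ conv])
      (simp_all add: R_def coeff_zero)
  then show ?thesis
    by (auto simp: R_def)
qed

text \<open>Let \<open>U\<close> invert the compression of \<open>S2\<close>. The component of \<open>V\<close> orthogonal to \<open>ker (A 0)\<close> is
  dictated by \<open>A 0 V + A 1 U = 0\<close>; its component in \<open>ker (A 0)\<close> is chosen with \<open>L\<close> such that
  \<open>I - A 1 V - A 2 U\<close> takes values in \<open>ran (A 0)\<close>, so that \<open>W\<close> exists. Such a choice is possible
  because \<open>P (I - S2 U)\<close> vanishes under the projection \<open>P2\<close> on the cokernel of the compression of \<open>A 1\<close>.\<close>

lemma second_order_laurent:
  assumes "range T2 = UNIV"
  shows "\<exists>\<Upsilon>. inverse_has_laurent_series F z0 2 \<Upsilon> \<and> (\<forall>y. P2 (S2 (\<Upsilon> (- 2) y)) = P2 y)"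
proof -
  define U where "U = mp_inverse UNIV UNIV T2 o\<^sub>C\<^sub>L P2"
  have "Proj {0} x = 0" for x :: 'a
    using Proj_in[OF closed_csubspace_orth_compl, of UNIV x] by simp
  then have T2_U: "T2 (U y) = P2 y" for y
    using mp_inverse_id_minus_compact(1)[OF compact_bordered[OF compact_T1 compact_S2], of "P2 y"]
    by (simp add: U_def assms)
  have U_in: "U y \<in> ker T1" for y
    by (rule bordered_eq_imp_ker[OF compact_T1 compact_S2]) (simp add: T2_U Proj_fixes)
  have P2_S2_U: "P2 (S2 (U y)) = P2 y" for y
    using T2_U[of y] bordered_apply_ker[OF compact_T1 compact_S2 U_in] by simp
  have A0_U: "A 0 (U y) = 0" and P_A1_U: "P (A 1 (U y)) = 0" for y
    using U_in[of y] by (simp_all add: ker_T1) (simp add: ker_def)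
  define V where "V = L - L o\<^sub>C\<^sub>L S2 o\<^sub>C\<^sub>L U - G o\<^sub>C\<^sub>L A 1 o\<^sub>C\<^sub>L U"
  define W where "W = G o\<^sub>C\<^sub>L (id_cblinfun - A 1 o\<^sub>C\<^sub>L V - A 2 o\<^sub>C\<^sub>L U)"
  define R where "R n = (if n = 0 then U else if n = 1 then V else if n = 2 then W else 0)" for n :: nat
  have eq1: "A 0 (V y) + A 1 (U y) = 0" for y
    by (simp add: V_def cblinfun_apply_diff A0_L A0_G P_A1_U)
  have P_A1_V: "P (A 1 (V y)) = P y - P (A 2 (U y))" for y
  proof -
    have "V y = L (y - S2 (U y)) - G (A 1 (U y))"
      by (simp add: V_def cblinfun_apply_diff)
    then have "P (A 1 (V y)) = P (y - S2 (U y)) - P2 (y - S2 (U y)) - P (A 1 (G (A 1 (U y))))"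
      using P_A1_L[of "y - S2 (U y)"] by (simp only: cblinfun_apply_diff)
    also have "P2 (y - S2 (U y)) = 0"
      using P2_S2_U[of y] by (simp only: cblinfun_apply_diff) simp
    finally show ?thesis
      by (simp add: cblinfun_apply_diff)
  qed
  have eq2: "A 0 (W y) + A 1 (V y) + A 2 (U y) = y" for y
    using P_A1_V[of y] by (simp add: W_def A0_G cblinfun_apply_diff)
  have conv: "conv A R n = (if n = 2 then id_cblinfun else 0)" if n: "n \<le> 2" for n
  proof -
    consider "n = 0" | "n = 1" | "n = 2"
      using n by linarith
    then show ?thesis
    proof cases
      case 1
      then show ?thesis
        by (auto simp: conv_low_order R_def A0_U intro!: cblinfun_eqI)
    next
      case 2
      then show ?thesis
        using eq1 by (auto simp: conv_low_order R_def intro!: cblinfun_eqI)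
    next
      case 3
      then show ?thesis
        using eq2 by (auto simp: conv_low_order R_def intro!: cblinfun_eqI)
    qed
  qed
  have "\<exists>\<Upsilon>. inverse_has_laurent_series F z0 2 \<Upsilon> \<and> \<Upsilon> (- int 2) = R 0"
    by (rule right_parametrix_imp_laurent[OF expansion _ compact_F _ conv])
      (simp_all add: R_def coeff_zero)
  then show ?thesis
    using P2_S2_U by (auto simp: R_def)
qed

context
  fixes \<Upsilon> :: "int \<Rightarrow> 'a \<Rightarrow>\<^sub>C\<^sub>L 'a"
  assumes laurent: "inverse_has_laurent_series F z0 2 \<Upsilon>"
begin

lemma coefficient_equations:
  "A 0 (\<Upsilon> (-2) y) = 0"
  "A 0 (\<Upsilon> (-1) y) + A 1 (\<Upsilon> (-2) y) = 0"
  "A 0 (\<Upsilon> 0 y) + A 1 (\<Upsilon> (-1) y) + A 2 (\<Upsilon> (-2) y) = y"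
  "A 0 (\<Upsilon> 1 y) + A 1 (\<Upsilon> 0 y) + A 2 (\<Upsilon> (-1) y) + A 3 (\<Upsilon> (-2) y) = 0"
proof -
  have "conv A (\<lambda>n. \<Upsilon> (int n - int 2)) n = (if n = 2 then id_cblinfun else 0)" for n
    by (rule laurent_coefficients[OF expansion _ laurent]) (simp add: coeff_zero)
  note eq = arg_cong[OF this, of "\<lambda>X. X y"]
  show "A 0 (\<Upsilon> (-2) y) = 0"
    using eq[of 0] by (simp add: conv_low_order)
  show "A 0 (\<Upsilon> (-1) y) + A 1 (\<Upsilon> (-2) y) = 0"
    using eq[of 1] by (simp add: conv_low_order)
  show "A 0 (\<Upsilon> 0 y) + A 1 (\<Upsilon> (-1) y) + A 2 (\<Upsilon> (-2) y) = y"
    using eq[of 2] by (simp add: conv_low_order)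
  show "A 0 (\<Upsilon> 1 y) + A 1 (\<Upsilon> 0 y) + A 2 (\<Upsilon> (-1) y) + A 3 (\<Upsilon> (-2) y) = 0"
    using eq[of 3] by (simp add: conv_low_order)
qed

abbreviation (input) "U \<equiv> \<Upsilon> (-2)"
abbreviation (input) "V \<equiv> \<Upsilon> (-1)"

lemma leading_coefficient_in_ker: "U y \<in> ker T1"
proof -
  have "P (A 0 (V y) + A 1 (U y)) = 0"
    by (simp add: coefficient_equations)
  then show ?thesis
    using coefficient_equations(1)[of y] by (simp add: ker_T1 cblinfun_apply_add P_A0) (simp add: ker_def)
qed

lemma V_decomposition: "V y = Q (V y) - G (A 1 (U y))"
proof -
  have "A 0 (V y) = - A 1 (U y)"
    using coefficient_equations(2)[of y] by (simp add: eq_neg_iff_add_eq_0)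
  then have "V y - Q (V y) = - G (A 1 (U y))"
    using G_A0[of "V y"] by (simp add: cblinfun_apply_minus)
  then show ?thesis
    by (simp add: algebra_simps)
qed

text \<open>The equation for the coefficient of \<open>w\<^sup>0\<close>, projected on \<open>(ran (A 0))\<^sup>\<bottom>\<close>; inserting the known component
  of \<open>V\<close> turns \<open>A 2\<close> into \<open>S2\<close>.\<close>

lemma P_A1_Q_V: "P (A 1 (Q (V y))) = P y - P (S2 (U y))"
proof -
  have "P (A 0 (\<Upsilon> 0 y) + A 1 (V y) + A 2 (U y)) = P y"
    by (simp only: coefficient_equations)
  then have "P (A 1 (V y)) + P (A 2 (U y)) = P y"
    by (simp add: cblinfun_apply_add P_A0)
  moreover have "P (A 1 (V y)) = P (A 1 (Q (V y))) - P (A 1 (G (A 1 (U y))))"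
    by (subst V_decomposition) (simp only: cblinfun_apply_diff)
  ultimately show ?thesis
    by (simp add: cblinfun_apply_diff algebra_simps)
qed

lemma P2_P: "P2 (P y) = P2 y"
proof -
  have "P2 (A 0 (G y)) = 0"
    by (rule P2_A0)
  then show ?thesis
    by (simp add: A0_G cblinfun_apply_diff)
qed

lemma P2_S2_U: "P2 (S2 (U y)) = P2 y"
proof -
  have "P2 (P (A 1 (Q (V y)))) = 0"
    by (simp only: P2_P) (simp add: P2_A1)
  then show ?thesis
    unfolding P_A1_Q_V by (simp only: cblinfun_apply_diff P2_P) simp
qed

text \<open>By \<open>P2_S2_U\<close>, \<open>y - S2 (U y)\<close> lies in the range of \<open>T1\<close>.\<close>

lemma T2_surj: "range T2 = UNIV"
proof -
  have "y \<in> range T2" for y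
  proof -
    have "P2 (y - S2 (U y)) = 0"
      using P2_S2_U[of y] by (simp only: cblinfun_apply_diff) simp
    then have "y - S2 (U y) \<in> range T1"
      by (simp only: Proj_eq_0_iff closed_csubspace_orth_compl
          orth_compl_orth_compl[OF closed_csubspace_range_id_minus_compact[OF compact_T1]])
    then have "(y - S2 (U y)) + S2 (U y) \<in> range T1 + S2 ` ker T1"
      using leading_coefficient_in_ker by (intro set_plus_intro imageI)
    then show ?thesis
      by (simp add: range_bordered[OF compact_T1 compact_S2])
  qed
  then show ?thesis
    by blast
qed

lemma compression_bij: "bij_betw (P2 o\<^sub>C\<^sub>L S2) (ker T1) (orth_compl (range T1))"
  using T2_surj bordered_surj_iff_bij[OF compact_T1 compact_S2] by blast

lemma leading_coefficient: "U y = inv_into (ker T1) (P2 o\<^sub>C\<^sub>L S2) (P2 y)"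
proof (rule inv_into_f_eq[symmetric])
  show "inj_on (P2 o\<^sub>C\<^sub>L S2) (ker T1)"
    using compression_bij by (rule bij_betw_imp_inj_on)
  show "(P2 o\<^sub>C\<^sub>L S2) (U y) = P2 y"
    using P2_S2_U by (simp only: cblinfun_apply_ops(8))
qed (rule leading_coefficient_in_ker)

lemma leading_coefficient_cong: "P2 y = P2 y' \<Longrightarrow> U y = U y'"
  by (simp add: leading_coefficient)

text \<open>\<open>U\<close> is a right inverse of the bijective compression of \<open>S2\<close> by \<open>P2_S2_U\<close>, hence also a left inverse.\<close>

lemma U_S2:
  assumes "x \<in> ker T1"
  shows "U (S2 x) = x"
proof -
  have "U (S2 x) = inv_into (ker T1) (P2 o\<^sub>C\<^sub>L S2) ((P2 o\<^sub>C\<^sub>L S2) x)"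
    by (simp only: leading_coefficient cblinfun_apply_ops(8))
  also have "\<dots> = x"
    using bij_betw_imp_inj_on[OF compression_bij] assms by (rule inv_into_f_f)
  finally show ?thesis .
qed

text \<open>\<open>L\<close> applied to \<open>P_A1_Q_V\<close>.\<close>

lemma Q_V: "Q (V y) = Q2 (V y) + L y - L (S2 (U y))"
proof -
  have "L (P (A 1 (Q (V y)))) = L (P y) - L (P (S2 (U y)))"
    unfolding P_A1_Q_V by (rule cblinfun_apply_diff)
  then have "Q (V y) - Q2 (V y) = L y - L (S2 (U y))"
    unfolding L_P using L_A1[of "Q (V y)"] by (simp add: Q2_Q)
  then show ?thesis
    by (simp add: algebra_simps)
qed

text \<open>The equation for the coefficient of \<open>w\<close>, projected with \<open>P2\<close>. The component of the coefficient
  \<open>\<Upsilon> 0\<close> in \<open>ker (A 0)\<close> is unknown but disappears, as \<open>A 1\<close> maps it to the kernel of \<open>P2\<close>. Since \<open>U\<close> factors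
  through \<open>P2\<close>, the resulting equation can be stated with \<open>U\<close> in place of \<open>P2\<close>.\<close>

lemma third_equation: "U (A 1 (G y) + S2 (V y) - A 1 (G (A 2 (U y))) + A 3 (U y)) = 0"
proof -
  have "A 0 (\<Upsilon> 0 y) = y - A 1 (V y) - A 2 (U y)"
    using coefficient_equations(3)[of y] by (simp add: eq_diff_eq add_ac)
  then have "G (A 0 (\<Upsilon> 0 y)) = G (y - A 1 (V y) - A 2 (U y))"
    by (rule arg_cong)
  then have W: "\<Upsilon> 0 y = Q (\<Upsilon> 0 y) + (G y - G (A 1 (V y)) - G (A 2 (U y)))"
    unfolding G_A0 cblinfun_apply_diff by (metis diff_eq_eq add.commute)
  have "P2 (A 1 (Q (\<Upsilon> 0 y))) = 0"
    by (rule P2_A1) simp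
  then have W': "P2 (A 1 (\<Upsilon> 0 y)) = P2 (A 1 (G y - G (A 1 (V y)) - G (A 2 (U y))))"
    by (subst W) (simp only: cblinfun_apply_add add_0)
  have "P2 (A 0 (\<Upsilon> 1 y) + A 1 (\<Upsilon> 0 y) + A 2 (V y) + A 3 (U y)) = 0"
    by (simp only: coefficient_equations cblinfun_apply_zero)
  then have "P2 (A 1 (G y) + S2 (V y) - A 1 (G (A 2 (U y))) + A 3 (U y)) = P2 0"
    by (simp add: cblinfun_apply_add cblinfun_apply_diff P2_A0 W' algebra_simps)
  from leading_coefficient_cong[OF this] show ?thesis
    by simp
qed

text \<open>The components of \<open>V\<close> outside \<open>ker T1\<close> are known from \<open>V_decomposition\<close> and \<open>Q_V\<close>; as \<open>U S2\<close> is the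
  identity on \<open>ker T1\<close>, \<open>third_equation\<close> determines the component \<open>Q2 V\<close> in terms of them.\<close>

lemma second_coefficient:
  "V = L - (L o\<^sub>C\<^sub>L S2 + G o\<^sub>C\<^sub>L A 1) o\<^sub>C\<^sub>L U - U o\<^sub>C\<^sub>L (S2 o\<^sub>C\<^sub>L L + A 1 o\<^sub>C\<^sub>L G)
    + U o\<^sub>C\<^sub>L (A 1 o\<^sub>C\<^sub>L G o\<^sub>C\<^sub>L S2 + S2 o\<^sub>C\<^sub>L G o\<^sub>C\<^sub>L A 1 + S2 o\<^sub>C\<^sub>L L o\<^sub>C\<^sub>L S2 - S3) o\<^sub>C\<^sub>L U"
proof (rule cblinfun_eqI)
  fix y
  define u where "u = U y"
  define S where "S = S2"
  have V: "V y = Q2 (V y) + (L y - L (S u) - G (A 1 u))"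
    unfolding u_def S_def by (subst V_decomposition, subst Q_V) (simp only: add_diff_eq)
  have "U (S (V y)) = U (S (Q2 (V y))) + U (S (L y - L (S u) - G (A 1 u)))"
    by (subst V) (simp only: cblinfun_apply_add)
  also have "U (S (Q2 (V y))) = Q2 (V y)"
    unfolding S_def by (rule U_S2) simp
  finally have Q2_V: "Q2 (V y) = U (S (V y)) - U (S (L y - L (S u) - G (A 1 u)))"
    by simp
  have "U (A 1 (G y)) + U (S (V y)) - U (A 1 (G (A 2 u))) + U (A 3 u) = 0"
    using third_equation[of y] unfolding u_def S_def by (simp only: cblinfun_apply_add cblinfun_apply_diff)
  then have US: "U (S (V y)) = U (A 1 (G (A 2 u))) - U (A 1 (G y)) - U (A 3 u)"
    by (simp add: algebra_simps)
  have A2: "A 2 u = S u + A 1 (G (A 1 u))"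
    by (simp add: S_def)
  have S3: "S3 u = A 3 u - A 1 (G (A 1 (G (A 1 u))))"
    by simp
  show "V y = (L - (L o\<^sub>C\<^sub>L S2 + G o\<^sub>C\<^sub>L A 1) o\<^sub>C\<^sub>L U - U o\<^sub>C\<^sub>L (S2 o\<^sub>C\<^sub>L L + A 1 o\<^sub>C\<^sub>L G)
    + U o\<^sub>C\<^sub>L (A 1 o\<^sub>C\<^sub>L G o\<^sub>C\<^sub>L S2 + S2 o\<^sub>C\<^sub>L G o\<^sub>C\<^sub>L A 1 + S2 o\<^sub>C\<^sub>L L o\<^sub>C\<^sub>L S2 - S3) o\<^sub>C\<^sub>L U) y"
    unfolding S_def[symmetric]
    by (subst V, subst Q2_V, subst US, subst A2)
      (simp add: u_def[symmetric] cblinfun_apply_add cblinfun_apply_diff algebra_simps)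
qed

end

lemma second_order_pole_iff:
  assumes "\<not> invertible_cblinfun (F z0)" "\<not> inverse_has_pole_of_order F z0 1"
  shows "inverse_has_pole_of_order F z0 2 \<longleftrightarrow> range T2 = UNIV"
proof
  assume "inverse_has_pole_of_order F z0 2"
  then show "range T2 = UNIV"
    using T2_surj by (auto simp: inverse_has_pole_of_order_def)
next
  assume "range T2 = UNIV"
  from second_order_laurent[OF this] obtain \<Upsilon>
    where \<Upsilon>: "inverse_has_laurent_series F z0 2 \<Upsilon>" "\<And>y. P2 (S2 (\<Upsilon> (- 2) y)) = P2 y"
    by blast
  have "\<Upsilon> (- 2) \<noteq> 0"
  proof
    \<comment> \<open>Otherwise the compression of \<open>A 1\<close> is onto, the pole is at most simple, and hence there is
      no pole at all.\<close>
    assume "\<Upsilon> (- 2) = 0"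
    then have P2: "P2 y = 0" for y
      using \<Upsilon>(2)[of y] by simp
    then have "y \<in> range T1" for y
      using Proj_eq_0_iff[OF closed_csubspace_orth_compl]
        orth_compl_orth_compl[OF closed_csubspace_range_id_minus_compact[OF compact_T1]] by blast
    then obtain \<Upsilon>' where "inverse_has_laurent_series F z0 1 \<Upsilon>'" "\<Upsilon>' (- 1) = L"
      using simple_pole_laurent by blast
    then have "L = 0"
      using assms(2) unfolding inverse_has_pole_of_order_def by force
    then have P0: "P y = 0" for y
      using P_A1_L[of y] P2[of y] by simp
    have AG: "A 0 (G y) = y" for y
      using A0_G[of y] by (simp add: P0)
    then have "range (A 0) = UNIV"
      by (metis surjI)
    then have "N0 = {0}"
      by (rule id_minus_compact_surj_imp_inj[OF compact_A0])
    then have "Q x = 0" for x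
      using Proj_in[OF closed_csubspace_ker, of "A 0" x] by simp
    then have "is_inverse_cblinfun (A 0) G"
      using AG G_A0 by (auto simp: is_inverse_cblinfun_def intro!: cblinfun_eqI)
    then show False
      using assms(1) by (auto simp: F_centre invertible_cblinfun_def)
  qed
  then show "inverse_has_pole_of_order F z0 2"
    using \<Upsilon>(1) by (auto simp: inverse_has_pole_of_order_def)
qed

end

theorem theorem4p2:
  fixes p :: nat
    and \<phi> :: "nat \<Rightarrow> 'a::chilbert_space \<Rightarrow>\<^sub>C\<^sub>L 'a"
    and \<Phi> :: "complex \<Rightarrow> 'a \<Rightarrow>\<^sub>C\<^sub>L 'a"
    and \<Pi>\<^sub>0 \<Pi>\<^sub>1 \<Pi>\<^sub>2 \<Pi>\<^sub>3 \<Pi>\<^sub>0_plus \<Lambda>\<^sub>1 \<Lambda>\<^sub>1_plus \<Lambda>\<^sub>2 :: "'a \<Rightarrow>\<^sub>C\<^sub>L 'a"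
    and \<alpha>\<^sub>1 \<beta>\<^sub>1 \<alpha>\<^sub>2 \<beta>\<^sub>2 :: "'a set"
  assumes separable: "separable_space (euclidean :: 'a topology)"
    and p: "p \<ge> 1"
    and compact: "\<forall>j\<in>{1..p}. compact_cblinfun (\<phi> j)"
    and \<Phi>: "\<Phi> = (\<lambda>z. id_cblinfun - (\<Sum>j=1..p. z ^ j *\<^sub>C \<phi> j))"
    and noninvertible: "\<not> invertible_cblinfun (\<Phi> 1)"
    and invertible: "\<forall>z. cmod z \<le> 1 \<and> z \<noteq> 1 \<longrightarrow> invertible_cblinfun (\<Phi> z)"
    and \<Pi>\<^sub>0: "\<Pi>\<^sub>0 = \<Phi> 1"
    and \<Pi>\<^sub>0_plus: "\<Pi>\<^sub>0_plus = mp_inverse UNIV UNIV \<Pi>\<^sub>0"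
    and \<Pi>\<^sub>1: "\<Pi>\<^sub>1 = cderiv \<Phi> 1"
    and \<Pi>\<^sub>2: "\<Pi>\<^sub>2 = (1/2) *\<^sub>C (cderiv ^^ 2) \<Phi> 1 - \<Pi>\<^sub>1 o\<^sub>C\<^sub>L \<Pi>\<^sub>0_plus o\<^sub>C\<^sub>L \<Pi>\<^sub>1"
    and \<Pi>\<^sub>3: "\<Pi>\<^sub>3 = (1/6) *\<^sub>C (cderiv ^^ 3) \<Phi> 1 - \<Pi>\<^sub>1 o\<^sub>C\<^sub>L \<Pi>\<^sub>0_plus o\<^sub>C\<^sub>L \<Pi>\<^sub>1 o\<^sub>C\<^sub>L \<Pi>\<^sub>0_plus o\<^sub>C\<^sub>L \<Pi>\<^sub>1"
    and \<alpha>\<^sub>1: "\<alpha>\<^sub>1 = range \<Pi>\<^sub>0"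
    and \<beta>\<^sub>1: "\<beta>\<^sub>1 = orth_compl (ker \<Pi>\<^sub>0)"
    and \<alpha>\<^sub>2: "\<alpha>\<^sub>2 = \<alpha>\<^sub>1 + \<Pi>\<^sub>1 ` orth_compl \<beta>\<^sub>1"
    and \<beta>\<^sub>2: "\<beta>\<^sub>2 = \<beta>\<^sub>1 + adjoint_cblinfun \<Pi>\<^sub>1 ` orth_compl \<alpha>\<^sub>1"
    and \<Lambda>\<^sub>1: "\<Lambda>\<^sub>1 = Proj (orth_compl \<alpha>\<^sub>1) o\<^sub>C\<^sub>L \<Pi>\<^sub>1"
    and \<Lambda>\<^sub>1_plus: "\<Lambda>\<^sub>1_plus = mp_inverse (orth_compl \<beta>\<^sub>1) (orth_compl \<alpha>\<^sub>1) \<Lambda>\<^sub>1"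
    and \<Lambda>\<^sub>2: "\<Lambda>\<^sub>2 = Proj (orth_compl \<alpha>\<^sub>2) o\<^sub>C\<^sub>L \<Pi>\<^sub>2"
    and not_simple: "\<not> inverse_has_pole_of_order \<Phi> 1 1"
  shows
    "(inverse_has_pole_of_order \<Phi> 1 2 \<longleftrightarrow> bij_betw \<Lambda>\<^sub>2 (orth_compl \<beta>\<^sub>2) (orth_compl \<alpha>\<^sub>2)) \<and>
     (inverse_has_pole_of_order \<Phi> 1 2 \<longleftrightarrow>
        UNIV = \<alpha>\<^sub>2 + \<Pi>\<^sub>2 ` orth_compl \<beta>\<^sub>2 \<and> \<alpha>\<^sub>2 \<inter> \<Pi>\<^sub>2 ` orth_compl \<beta>\<^sub>2 = {0}) \<and>
     (inverse_has_pole_of_order \<Phi> 1 2 \<longleftrightarrow> UNIV = \<alpha>\<^sub>2 + \<Pi>\<^sub>2 ` orth_compl \<beta>\<^sub>2) \<and>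
     (\<forall>\<Upsilon>. inverse_has_pole_of_order \<Phi> 1 2 \<and> inverse_has_laurent_series \<Phi> 1 2 \<Upsilon> \<longrightarrow>
        (\<forall>x. \<Upsilon> (-2) x = inv_into (orth_compl \<beta>\<^sub>2) \<Lambda>\<^sub>2 (Proj (orth_compl \<alpha>\<^sub>2) x)) \<and>
        \<Upsilon> (-1) =
          \<Lambda>\<^sub>1_plus o\<^sub>C\<^sub>L Proj (orth_compl \<alpha>\<^sub>1)
          - (\<Lambda>\<^sub>1_plus o\<^sub>C\<^sub>L Proj (orth_compl \<alpha>\<^sub>1) o\<^sub>C\<^sub>L \<Pi>\<^sub>2 + \<Pi>\<^sub>0_plus o\<^sub>C\<^sub>L \<Pi>\<^sub>1) o\<^sub>C\<^sub>L \<Upsilon> (-2)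
          - \<Upsilon> (-2) o\<^sub>C\<^sub>L (\<Pi>\<^sub>2 o\<^sub>C\<^sub>L \<Lambda>\<^sub>1_plus o\<^sub>C\<^sub>L Proj (orth_compl \<alpha>\<^sub>1) + \<Pi>\<^sub>1 o\<^sub>C\<^sub>L \<Pi>\<^sub>0_plus)
          + \<Upsilon> (-2) o\<^sub>C\<^sub>L
            (\<Pi>\<^sub>1 o\<^sub>C\<^sub>L \<Pi>\<^sub>0_plus o\<^sub>C\<^sub>L \<Pi>\<^sub>2 + \<Pi>\<^sub>2 o\<^sub>C\<^sub>L \<Pi>\<^sub>0_plus o\<^sub>C\<^sub>L \<Pi>\<^sub>1
             + \<Pi>\<^sub>2 o\<^sub>C\<^sub>L \<Lambda>\<^sub>1_plus o\<^sub>C\<^sub>L Proj (orth_compl \<alpha>\<^sub>1) o\<^sub>C\<^sub>L \<Pi>\<^sub>2 - \<Pi>\<^sub>3) o\<^sub>C\<^sub>L \<Upsilon> (-2))"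
proof -
  define B where "B j = (if j = 0 then id_cblinfun else - \<phi> j)" for j
  define A where "A k = (\<Sum>j\<le>p. (of_nat (j choose k) * 1 ^ (j - k)) *\<^sub>C B j)" for k
  have pencil: "\<Phi> = (\<lambda>z. \<Sum>j\<le>p. z ^ j *\<^sub>C B j)"
  proof
    fix z
    have "{..p} = insert 0 {1..p}"
      by auto
    then have "(\<Sum>j\<le>p. z ^ j *\<^sub>C B j) = id_cblinfun + (\<Sum>j=1..p. z ^ j *\<^sub>C B j)"
      by (simp add: B_def)
    also have "(\<Sum>j=1..p. z ^ j *\<^sub>C B j) = (\<Sum>j=1..p. - (z ^ j *\<^sub>C \<phi> j))"
      by (intro sum.cong) (auto simp: B_def)
    finally show "\<Phi> z = (\<Sum>j\<le>p. z ^ j *\<^sub>C B j)"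
      by (simp add: \<Phi> sum_negf)
  qed
  have derivative: "(cderiv ^^ k) \<Phi> 1 = fact k *\<^sub>C A k" for k
    unfolding pencil funpow_cderiv_pencil A_def by (simp add: scaleC_sum_right scaleC_scaleC)
  interpret compact_pencil \<Phi> A 1 p
  proof
    show "\<Phi> z = (\<Sum>k\<le>p. (z - 1) ^ k *\<^sub>C A k)" for z
      unfolding pencil A_def by (rule pencil_Taylor)
    show "A k = 0" if "k > p" for k
      unfolding A_def using that by (intro sum.neutral) (auto simp: binomial_eq_0)
    show "compact_cblinfun (id_cblinfun - \<Phi> z)" for z
      unfolding \<Phi> using compact by (auto intro!: compact_cblinfun_sum compact_cblinfun_scaleC)
    show "compact_cblinfun (A k)" if "k \<ge> 1" for k
      unfolding A_def
    proof (rule compact_cblinfun_sum)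
      fix j assume "j \<in> {..p}"
      show "compact_cblinfun ((of_nat (j choose k) * 1 ^ (j - k)) *\<^sub>C B j)"
      proof (cases "j = 0")
        case True
        then show ?thesis
          using that by (simp add: binomial_eq_0 compact_cblinfun_zero)
      next
        case False
        then show ?thesis
          using compact \<open>j \<in> {..p}\<close>
          by (intro compact_cblinfun_scaleC) (simp add: B_def compact_cblinfun_minus)
      qed
    qed
  qed
  \<comment> \<open>The translation of all data of the theorem into those of the pencil.\<close>
  have eqs: "\<Pi>\<^sub>0 = A 0" "\<Pi>\<^sub>1 = A 1" "\<Pi>\<^sub>0_plus = G" "\<Pi>\<^sub>2 = S2" "\<Pi>\<^sub>3 = S3"
  proof -
    show "\<Pi>\<^sub>0 = A 0"
      by (simp add: \<Pi>\<^sub>0 F_centre)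
    then show "\<Pi>\<^sub>0_plus = G"
      by (simp add: \<Pi>\<^sub>0_plus)
    moreover show "\<Pi>\<^sub>1 = A 1"
      using derivative[of 1] by (simp add: \<Pi>\<^sub>1 One_nat_def)
    ultimately show "\<Pi>\<^sub>2 = S2" "\<Pi>\<^sub>3 = S3"
      unfolding \<Pi>\<^sub>2 \<Pi>\<^sub>3 derivative by (simp_all add: scaleC_scaleC fact_numeral)
  qed
  have orth_\<beta>\<^sub>1: "orth_compl \<beta>\<^sub>1 = ker (A 0)"
    by (simp add: \<beta>\<^sub>1 eqs orth_compl_orth_compl)
  have \<alpha>\<^sub>2': "\<alpha>\<^sub>2 = range T1"
    unfolding \<alpha>\<^sub>2 orth_\<beta>\<^sub>1 by (simp add: \<alpha>\<^sub>1 eqs range_bordered[OF compact_A0 compact_A1])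
  \<comment> \<open>Being orthogonal to \<open>\<Pi>\<^sub>1\<^sup>* \<alpha>\<^sub>1\<^sup>\<bottom>\<close> means being mapped by \<open>\<Pi>\<^sub>1\<close> to \<open>\<alpha>\<^sub>1\<^sup>\<bottom>\<^sup>\<bottom>\<close>, which is the kernel of
    the projection on \<open>\<alpha>\<^sub>1\<^sup>\<bottom>\<close>.\<close>
  have orth_\<beta>\<^sub>2: "orth_compl \<beta>\<^sub>2 = ker T1"
  proof (rule set_eqI)
    fix x
    let ?adj = "adjoint_cblinfun (A 1)"
    have "x \<in> orth_compl \<beta>\<^sub>2 \<longleftrightarrow> (\<forall>b\<in>\<beta>\<^sub>1. \<forall>y\<in>orth_compl \<alpha>\<^sub>1. cinner x (b + ?adj y) = 0)"
      unfolding \<beta>\<^sub>2 eqs orth_compl_def[of "\<beta>\<^sub>1 + _"] by (auto elim!: set_plus_elim)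
    also have "\<dots> \<longleftrightarrow> (\<forall>b\<in>\<beta>\<^sub>1. cinner x b = 0) \<and> (\<forall>y\<in>orth_compl \<alpha>\<^sub>1. cinner x (?adj y) = 0)"
      (is "?l = ?r")
    proof
      assume l: ?l
      have "0 \<in> \<beta>\<^sub>1" "0 \<in> orth_compl \<alpha>\<^sub>1"
        by (simp_all add: \<beta>\<^sub>1 closed_csubspaceD(2))
      then have "cinner x (b + ?adj 0) = 0" "cinner x (0 + ?adj y) = 0"
        if "b \<in> \<beta>\<^sub>1" "y \<in> orth_compl \<alpha>\<^sub>1" for b y
        using l that by blast+
      then show ?r
        using \<open>0 \<in> \<beta>\<^sub>1\<close> \<open>0 \<in> orth_compl \<alpha>\<^sub>1\<close> by force
    qed (auto simp: cinner_add_right)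
    also have "\<dots> \<longleftrightarrow> x \<in> orth_compl \<beta>\<^sub>1 \<and> A 1 x \<in> orth_compl (orth_compl \<alpha>\<^sub>1)"
      by (simp add: cinner_adjoint[symmetric] orth_compl_def)
    also have "\<dots> \<longleftrightarrow> x \<in> ker T1"
      unfolding orth_\<beta>\<^sub>1 ker_T1 \<alpha>\<^sub>1 eqs by (simp add: Proj_eq_0_iff)
    finally show "x \<in> orth_compl \<beta>\<^sub>2 \<longleftrightarrow> x \<in> ker T1" .
  qed
  have \<Lambda>\<^sub>2': "\<Lambda>\<^sub>2 = P2 o\<^sub>C\<^sub>L S2"
    by (simp add: \<Lambda>\<^sub>2 \<alpha>\<^sub>2' eqs)
  have L: "\<Lambda>\<^sub>1_plus o\<^sub>C\<^sub>L Proj (orth_compl \<alpha>\<^sub>1) = L"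
    by (rule cblinfun_eqI) (simp add: \<Lambda>\<^sub>1_plus \<Lambda>\<^sub>1 orth_\<beta>\<^sub>1 \<alpha>\<^sub>1 eqs L_P)
  have pole: "inverse_has_pole_of_order \<Phi> 1 2 \<longleftrightarrow> range T2 = UNIV"
    using noninvertible not_simple by (rule second_order_pole_iff)
  have range_T2: "range T2 = \<alpha>\<^sub>2 + \<Pi>\<^sub>2 ` orth_compl \<beta>\<^sub>2"
    unfolding \<alpha>\<^sub>2' orth_\<beta>\<^sub>2 eqs by (rule range_bordered[OF compact_T1 compact_S2])
  have bij: "inverse_has_pole_of_order \<Phi> 1 2 \<longleftrightarrow> bij_betw \<Lambda>\<^sub>2 (orth_compl \<beta>\<^sub>2) (orth_compl \<alpha>\<^sub>2)"
    unfolding pole \<Lambda>\<^sub>2' orth_\<beta>\<^sub>2 \<alpha>\<^sub>2' by (rule bordered_surj_iff_bij[OF compact_T1 compact_S2])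
  have sum: "inverse_has_pole_of_order \<Phi> 1 2 \<longleftrightarrow> UNIV = \<alpha>\<^sub>2 + \<Pi>\<^sub>2 ` orth_compl \<beta>\<^sub>2"
    unfolding pole range_T2 by (rule eq_commute)
  have direct: "\<alpha>\<^sub>2 \<inter> \<Pi>\<^sub>2 ` orth_compl \<beta>\<^sub>2 = {0}" if "inverse_has_pole_of_order \<Phi> 1 2"
    using that bordered_surj_imp_direct[OF compact_T1 compact_S2]
    unfolding pole \<alpha>\<^sub>2' orth_\<beta>\<^sub>2 eqs by blast
  have leading: "\<Upsilon> (-2) x = inv_into (orth_compl \<beta>\<^sub>2) \<Lambda>\<^sub>2 (Proj (orth_compl \<alpha>\<^sub>2) x)"
    if "inverse_has_laurent_series \<Phi> 1 2 \<Upsilon>" for \<Upsilon> x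
    unfolding \<Lambda>\<^sub>2' orth_\<beta>\<^sub>2 \<alpha>\<^sub>2' using that by (rule leading_coefficient)
  have second: "\<Upsilon> (-1) = \<Lambda>\<^sub>1_plus o\<^sub>C\<^sub>L Proj (orth_compl \<alpha>\<^sub>1)
          - (\<Lambda>\<^sub>1_plus o\<^sub>C\<^sub>L Proj (orth_compl \<alpha>\<^sub>1) o\<^sub>C\<^sub>L \<Pi>\<^sub>2 + \<Pi>\<^sub>0_plus o\<^sub>C\<^sub>L \<Pi>\<^sub>1) o\<^sub>C\<^sub>L \<Upsilon> (-2)
          - \<Upsilon> (-2) o\<^sub>C\<^sub>L (\<Pi>\<^sub>2 o\<^sub>C\<^sub>L \<Lambda>\<^sub>1_plus o\<^sub>C\<^sub>L Proj (orth_compl \<alpha>\<^sub>1) + \<Pi>\<^sub>1 o\<^sub>C\<^sub>L \<Pi>\<^sub>0_plus)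
          + \<Upsilon> (-2) o\<^sub>C\<^sub>L
            (\<Pi>\<^sub>1 o\<^sub>C\<^sub>L \<Pi>\<^sub>0_plus o\<^sub>C\<^sub>L \<Pi>\<^sub>2 + \<Pi>\<^sub>2 o\<^sub>C\<^sub>L \<Pi>\<^sub>0_plus o\<^sub>C\<^sub>L \<Pi>\<^sub>1
             + \<Pi>\<^sub>2 o\<^sub>C\<^sub>L \<Lambda>\<^sub>1_plus o\<^sub>C\<^sub>L Proj (orth_compl \<alpha>\<^sub>1) o\<^sub>C\<^sub>L \<Pi>\<^sub>2 - \<Pi>\<^sub>3) o\<^sub>C\<^sub>L \<Upsilon> (-2)"
    if "inverse_has_laurent_series \<Phi> 1 2 \<Upsilon>" for \<Upsilon>
  proof -
    have "\<Pi>\<^sub>2 o\<^sub>C\<^sub>L \<Lambda>\<^sub>1_plus o\<^sub>C\<^sub>L Proj (orth_compl \<alpha>\<^sub>1) = S2 o\<^sub>C\<^sub>L L"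
      unfolding L[symmetric] eqs by (rule cblinfun_compose_simps(11))
    then show ?thesis
      unfolding L eqs by (simp only: second_coefficient[OF that, symmetric])
  qed
  show ?thesis
  proof (intro conjI)
    show "inverse_has_pole_of_order \<Phi> 1 2 \<longleftrightarrow> bij_betw \<Lambda>\<^sub>2 (orth_compl \<beta>\<^sub>2) (orth_compl \<alpha>\<^sub>2)"
      by (rule bij)
    show "inverse_has_pole_of_order \<Phi> 1 2 \<longleftrightarrow>
        UNIV = \<alpha>\<^sub>2 + \<Pi>\<^sub>2 ` orth_compl \<beta>\<^sub>2 \<and> \<alpha>\<^sub>2 \<inter> \<Pi>\<^sub>2 ` orth_compl \<beta>\<^sub>2 = {0}"
      using sum direct by blast
    show "inverse_has_pole_of_order \<Phi> 1 2 \<longleftrightarrow> UNIV = \<alpha>\<^sub>2 + \<Pi>\<^sub>2 ` orth_compl \<beta>\<^sub>2"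
      by (rule sum)
  qed (rule allI, rule impI, rule conjI, rule allI, erule leading[OF conjunct2],
      erule second[OF conjunct2])
qed

end
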